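(* Let $F$ be a field. For every non-empty finite subset $B$ of $\mathbb N$ let $E_B\in F\Pi_B$ be a $\Delta$-primitive idempotent, and set $E_Q=E_{Q_1}\vee\cdots\vee E_{Q_k}$ for all $Q=(Q_1,\ldots,Q_k)\in\Pi$. Let $A$ be a finite subset of $\mathbb N$. For each $Q\in\Pi_A$, $$\Lambda_Q:=F\Pi_A\wedge E_Q=\mathrm{span}_F\{E_{Q'}\mid Q'\in\Pi_A,\ Q'\approx Q\}$$ is an indecomposable left $F\Pi_A$-module, with radical $$\mathrm{rad}_{F\Pi_A}\Lambda_Q=\mathrm{span}_F\{E_Q-E_{Q'}\mid Q'\in\Pi_A,\ Q'\approx Q\}$$ of codimension $1$ in $\Lambda_Q$. In particular, $$F\Pi_A=\bigoplus_{Q\in\Pi_A^<}\Lambda_Q$$ is a decomposition into indecomposable submodules, and $$\mathrm{rad}\,F\Pi_A=\mathrm{span}_F\{E_Q-E_{Q'}\mid Q\in\Pi_A^<,\ Q'\in\Pi_A,\ Q'\approx Q\}.$$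
   Context: For a finite subset $A$ of $\mathbb N=\{1,2,\ldots\}$, a set composition of $A$ is a tuple $P=(P_1,\ldots,P_l)$ of mutually disjoint non-empty subsets of $A$ with union $A$; $\Pi_A$ is the set of all set compositions of $A$. $\Pi_\emptyset$ consists of the empty tuple, denoted $\emptyset$ (and $E_\emptyset=\emptyset$ for the empty tuple). $\Pi=\bigcup_A\Pi_A$; $F\Pi_A$ is the $F$-vector space with basis $\Pi_A$ and $F\Pi=\bigoplus_AF\Pi_A$, over all finite $A\subset\mathbb N$. Bilinear products on $F\Pi$: for $P=(P_1,\ldots,P_l)\in\Pi_A$, $Q=(Q_1,\ldots,Q_k)\in\Pi_B$, $P\wedge Q=(P_1\cap Q_1,\ldots,P_1\cap Q_k,\ldots,P_l\cap Q_1,\ldots,P_l\cap Q_k)$ with empty sets deleted if $A=B$, and $0$ if $A\neq B$; $P\vee Q=(P_1,\ldots,P_l,Q_1,\ldots,Q_k)$ if $A\cap B=\emptyset$, and $0$ otherwise. $F\Pi_A$ is regarded as an associative algebra with identity under $\wedge$. Coproduct: the linear map $\Delta:F\Pi\to F\Pi\otimes F\Pi$ with $\Delta(P)=\sum_{X\subseteq A}P|_X\otimes P|_{A\setminus X}$ for $P\in\Pi_A$, where $P|_X$ is $(P_1\cap X,\ldots,P_l\cap X)$ with empty sets deleted. A $\Delta$-primitive idempotent in $F\Pi_B$ is a non-zero $E\in F\Pi_B$ with $\Delta(E)=E\otimes\emptyset+\emptyset\otimes E$ and $E\wedge E=E$. For $P,Q\in\Pi_A$, $Q\approx P$ means that $Q$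 is obtained by rearranging the components of $P$. $\Pi_A^<=\{(Q_1,\ldots,Q_k)\in\Pi_A\mid\min Q_1<\cdots<\min Q_k\}$. All modules are left modules; $\mathrm{rad}_{\mathcal A}M$ is the intersection of all maximal submodules of the $\mathcal A$-module $M$, and $\mathrm{rad}\,\mathcal A=\mathrm{rad}_{\mathcal A}\mathcal A$ is the Jacobson radical. *)

theory Defs
  imports Complex_Main "HOL-Library.Poly_Mapping" "HOL-Library.Multiset" "HOL-Library.Disjoint_Sets"
    "HOL-Library.FuncSet"
begin

(* Modules over an F-algebra.  S is the carrier of an associative algebra with product mul and
   identity u, and act is the action.  Algebra and modules live in one ambient F-vector space,
   which is enough for left ideals. *)

locale vector_space_with_modules = vector_space scale
  for scale :: "'a::field \<Rightarrow> 'b::ab_group_add \<Rightarrow> 'b"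
begin

definition left_module ::
  "'b set \<Rightarrow> ('b \<Rightarrow> 'b \<Rightarrow> 'b) \<Rightarrow> 'b \<Rightarrow> ('b \<Rightarrow> 'b \<Rightarrow> 'b) \<Rightarrow> 'b set \<Rightarrow> bool" where
  "left_module S mul u act M \<longleftrightarrow>
     subspace M \<and>
     (\<forall>a\<in>S. \<forall>x\<in>M. act a x \<in> M) \<and>
     (\<forall>a\<in>S. \<forall>x\<in>M. \<forall>y\<in>M. act a (x + y) = act a x + act a y) \<and>
     (\<forall>a\<in>S. \<forall>b\<in>S. \<forall>x\<in>M. act (a + b) x = act a x + act b x) \<and>
     (\<forall>c. \<forall>a\<in>S. \<forall>x\<in>M. act (scale c a) x = scale c (act a x) \<and> act a (scale c x) = scale c (act a x)) \<and>
     (\<forall>a\<in>S. \<forall>b\<in>S. \<forall>x\<in>M. act (mul a b) x = act a (act b x)) \<and>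
     (\<forall>x\<in>M. act u x = x)"

definition submodule :: "'b set \<Rightarrow> ('b \<Rightarrow> 'b \<Rightarrow> 'b) \<Rightarrow> 'b set \<Rightarrow> 'b set \<Rightarrow> bool" where
  "submodule S act M N \<longleftrightarrow> N \<subseteq> M \<and> subspace N \<and> (\<forall>a\<in>S. \<forall>x\<in>N. act a x \<in> N)"

definition indecomposable :: "'b set \<Rightarrow> ('b \<Rightarrow> 'b \<Rightarrow> 'b) \<Rightarrow> 'b set \<Rightarrow> bool" where
  "indecomposable S act M \<longleftrightarrow>
     M \<noteq> {0} \<and>
     \<not> (\<exists>N N'. submodule S act M N \<and> submodule S act M N' \<and> N \<noteq> {0} \<and> N' \<noteq> {0} \<and>
             N \<inter> N' = {0} \<and> M = {x + y | x y. x \<in> N \<and> y \<in> N'})"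

definition maximal_submodule :: "'b set \<Rightarrow> ('b \<Rightarrow> 'b \<Rightarrow> 'b) \<Rightarrow> 'b set \<Rightarrow> 'b set \<Rightarrow> bool" where
  "maximal_submodule S act M N \<longleftrightarrow>
     submodule S act M N \<and> N \<noteq> M \<and>
     (\<forall>N'. submodule S act M N' \<longrightarrow> N \<subseteq> N' \<longrightarrow> N' = N \<or> N' = M)"

(* The leading M makes the empty intersection equal to M. *)
definition module_rad :: "'b set \<Rightarrow> ('b \<Rightarrow> 'b \<Rightarrow> 'b) \<Rightarrow> 'b set \<Rightarrow> 'b set" where
  "module_rad S act M = M \<inter> \<Inter>{N. maximal_submodule S act M N}"

definition finite_direct_sum ::
  "'b set \<Rightarrow> ('b \<Rightarrow> 'b \<Rightarrow> 'b) \<Rightarrow> 'b set \<Rightarrow> 'i set \<Rightarrow> ('i \<Rightarrow> 'b set) \<Rightarrow> bool" where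
  "finite_direct_sum S act M I N \<longleftrightarrow>
     finite I \<and> (\<forall>i\<in>I. submodule S act M (N i)) \<and>
     (\<forall>x\<in>M. \<exists>!f. f \<in> (\<Pi>\<^sub>E i\<in>I. N i) \<and> x = (\<Sum>i\<in>I. f i))"

end


(* Set compositions.  The finiteness of the ground set, and its being contained in {1..}, are
   imposed where the ground set is introduced. *)

definition set_compositions :: "nat set \<Rightarrow> nat set list set" where
  "set_compositions A = {P. distinct P \<and> partition_on A (set P)}"

definition ground :: "nat set list \<Rightarrow> nat set" where
  "ground P = \<Union>(set P)"

definition restrict_comp :: "nat set list \<Rightarrow> nat set \<Rightarrow> nat set list" where
  "restrict_comp P X = filter (\<lambda>Y. Y \<noteq> {}) (map (\<lambda>Y. Y \<inter> X) P)"

definition rearrangement :: "nat set list \<Rightarrow> nat set list \<Rightarrow> bool"  (infix "\<approx>" 50) where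
  "Q \<approx> P \<longleftrightarrow> mset Q = mset P"

definition ordered_set_compositions :: "nat set \<Rightarrow> nat set list set" where
  "ordered_set_compositions A = {Q \<in> set_compositions A. sorted_wrt (<) (map Min Q)}"


(* An element of F Pi is a finitely supported coefficient function.  The type also contains
   combinations of lists that are not set compositions; F_Pi A cuts out the right subspace. *)

type_synonym 'f comb = "nat set list \<Rightarrow>\<^sub>0 'f"

definition comb_scale :: "'f::field \<Rightarrow> 'f comb \<Rightarrow> 'f comb" where
  "comb_scale c x = Poly_Mapping.map ((*) c) x"

lemma lookup_comb_scale [simp]:
  "Poly_Mapping.lookup (comb_scale c x) P = c * Poly_Mapping.lookup x P"
  by (auto simp: comb_scale_def Poly_Mapping.map.rep_eq when_def)

global_interpretation comb: vector_space_with_modules "comb_scale :: 'f::field \<Rightarrow> 'f comb \<Rightarrow> 'f comb"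
  by unfold_locales (auto intro!: poly_mapping_eqI simp: lookup_add algebra_simps)

definition basis :: "nat set list \<Rightarrow> 'f::field comb" where
  "basis P = Poly_Mapping.single P 1"

definition F_Pi :: "nat set \<Rightarrow> 'f::field comb set" where
  "F_Pi A = {x. Poly_Mapping.keys x \<subseteq> set_compositions A}"

definition bilinear_ext ::
  "(nat set list \<Rightarrow> nat set list \<Rightarrow> 'f::field comb) \<Rightarrow> 'f comb \<Rightarrow> 'f comb \<Rightarrow> 'f comb" where
  "bilinear_ext f x y =
     (\<Sum>P\<in>Poly_Mapping.keys x. \<Sum>Q\<in>Poly_Mapping.keys y.
        comb_scale (Poly_Mapping.lookup x P * Poly_Mapping.lookup y Q) (f P Q))"

definition wedge :: "'f::field comb \<Rightarrow> 'f comb \<Rightarrow> 'f comb"  (infixl "\<^bold>\<and>" 70) where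
  "wedge = bilinear_ext (\<lambda>P Q.
     if ground P = ground Q
     then basis (filter (\<lambda>Z. Z \<noteq> {}) [X \<inter> Y. X \<leftarrow> P, Y \<leftarrow> Q]) else 0)"

definition vee :: "'f::field comb \<Rightarrow> 'f comb \<Rightarrow> 'f comb"  (infixr "\<^bold>\<or>" 65) where
  "vee = bilinear_ext (\<lambda>P Q. if ground P \<inter> ground Q = {} then basis (P @ Q) else 0)"

definition F_Pi_one :: "nat set \<Rightarrow> 'f::field comb" where
  "F_Pi_one A = basis (if A = {} then [] else [A])"


(* The tensor square of a space with basis L is the space with basis L \<times> L. *)

type_synonym 'f comb2 = "(nat set list \<times> nat set list) \<Rightarrow>\<^sub>0 'f"

definition tensor :: "'f::field comb \<Rightarrow> 'f comb \<Rightarrow> 'f comb2"  (infix "\<^bold>\<otimes>" 75) where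
  "x \<^bold>\<otimes> y =
     (\<Sum>P\<in>Poly_Mapping.keys x. \<Sum>Q\<in>Poly_Mapping.keys y.
        Poly_Mapping.single (P, Q) (Poly_Mapping.lookup x P * Poly_Mapping.lookup y Q))"

definition coproduct :: "'f::field comb \<Rightarrow> 'f comb2" where
  "coproduct x =
     (\<Sum>P\<in>Poly_Mapping.keys x. \<Sum>X\<in>Pow (ground P).
        Poly_Mapping.single (restrict_comp P X, restrict_comp P (ground P - X))
          (Poly_Mapping.lookup x P))"

definition primitive_idempotent :: "nat set \<Rightarrow> 'f::field comb \<Rightarrow> bool" where
  "primitive_idempotent B e \<longleftrightarrow>
     e \<in> F_Pi B \<and> e \<noteq> 0 \<and>
     coproduct e = e \<^bold>\<otimes> basis [] + basis [] \<^bold>\<otimes> e \<and>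
     e \<^bold>\<and> e = e"

(* basis [] is the identity of vee, so the final factor only serves the empty tuple. *)
definition E_tuple :: "(nat set \<Rightarrow> 'f::field comb) \<Rightarrow> nat set list \<Rightarrow> 'f comb" where
  "E_tuple E Q = foldr (\<lambda>B x. E B \<^bold>\<or> x) Q (basis [])"

definition Lambda :: "(nat set \<Rightarrow> 'f::field comb) \<Rightarrow> nat set \<Rightarrow> nat set list \<Rightarrow> 'f comb set" where
  "Lambda E A Q = {x \<^bold>\<and> E_tuple E Q | x. x \<in> F_Pi A}"

end

theory Submission
  imports Defs
begin

text \<open>
  Everything follows from one multiplication rule: for \<open>P, Q\<close> in \<open>\<Pi>\<^sub>A\<close>, the product
  \<open>P \<^bold>\<and> E\<^sub>Q\<close> is \<open>E\<close> at the composition \<open>P \<^bold>\<and> Q\<close> if every part of \<open>Q\<close> lies in a part of \<open>P\<close>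
  (\<open>Q\<close> is finer than \<open>P\<close>), and \<open>0\<close> otherwise.  In the first case \<open>P \<^bold>\<and> Q\<close> is a rearrangement
  of \<open>Q\<close>.  The reason is that multiplying a composition \<open>R\<close> by \<open>P\<close> from the left concatenates
  the restrictions of \<open>R\<close> to the parts of \<open>P\<close>, so it is read off from the coproduct.  For a
  primitive element of \<open>F\<Pi>\<^sub>B\<close>, the component of the coproduct at two complementary non-empty
  subsets of \<open>B\<close> is zero, and this kills \<open>P \<^bold>\<and> E\<^sub>Q\<close> when \<open>P\<close> splits a part of \<open>Q\<close>; if no part is split, the factors
  \<open>E\<close> at the parts of \<open>Q\<close> are only sorted by the parts of \<open>P\<close> containing them.  The rule is
  \<open>basis_wedge_E_tuple\<close>; it rests on \<open>primitive_restrict_eq_0\<close> and \<open>E_tuple_restrict\<close>.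

  Let \<open>\<chi>\<^sub>Q(x)\<close> be the sum of the coefficients of \<open>x\<close> at the compositions that are coarser than
  or equal to \<open>Q\<close>.  This functional is multiplicative for \<open>\<^bold>\<and>\<close>, and the multiplication rule
  yields \<open>\<chi>\<^sub>Q(E\<^sub>R) = 1\<close> if \<open>R\<close> rearranges \<open>Q\<close> and \<open>0\<close> otherwise (\<open>character_E_tuple\<close>).
  For \<open>x\<close> in \<open>\<Lambda>\<^sub>Q\<close> and a rearrangement \<open>Q'\<close> of \<open>Q\<close> it gives \<open>Q' \<^bold>\<and> x = \<chi>\<^sub>Q(x) E\<^sub>Q\<^sub>'\<close>
  (\<open>basis_wedge_Lambda\<close>).  Hence every \<open>x\<close> with \<open>\<chi>\<^sub>Q(x) \<noteq> 0\<close> generates \<open>\<Lambda>\<^sub>Q\<close>, so the kernel of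
  \<open>\<chi>\<^sub>Q\<close> on \<open>\<Lambda>\<^sub>Q\<close> contains every proper submodule.  This one fact gives indecomposability, the
  radical and its codimension.

  A primitive idempotent in \<open>F\<Pi>\<^sub>B\<close> has coefficient \<open>1\<close> at the one-part composition \<open>(B)\<close>, so
  \<open>E\<^sub>Q\<close> is \<open>Q\<close> plus a combination of compositions with more parts.  By triangularity the
  \<open>E\<^sub>Q\<close> form a basis of \<open>F\<Pi>\<^sub>A\<close>, and sorting them by rearrangement classes yields the direct
  sum.  For the radical of the algebra, every \<open>\<chi>\<^sub>Q\<close> has a maximal left ideal as its kernel,
  which bounds the radical from above; conversely the radical of each local submodule
  \<open>\<Lambda>\<^sub>Q\<close> lies in all maximal left ideals (\<open>radical_of_local_submodule\<close>).
\<close>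

section \<open>Linear extension of maps on a basis\<close>

text \<open>
  The products and characters below all arise from maps on basis elements.  The scaling is a
  parameter, so that one definition serves maps into \<open>F\<Pi>\<close> and functionals into the field, and
  the index type is free, so that it also applies to the tensor square.
\<close>

definition linear_extension ::
  "('a::field \<Rightarrow> 'b \<Rightarrow> 'b::ab_group_add) \<Rightarrow> ('k \<Rightarrow> 'b) \<Rightarrow> ('k \<Rightarrow>\<^sub>0 'a) \<Rightarrow> 'b" where
  "linear_extension s f x = (\<Sum>k\<in>Poly_Mapping.keys x. s (Poly_Mapping.lookup x k) (f k))"

context vector_space
begin

lemma linear_extension_superset:
  assumes "finite K" "Poly_Mapping.keys x \<subseteq> K"
  shows "linear_extension scale f x = (\<Sum>k\<in>K. scale (Poly_Mapping.lookup x k) (f k))"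
  unfolding linear_extension_def
  by (rule sum.mono_neutral_left) (use assms in \<open>auto simp: in_keys_iff\<close>)

lemma linear_extension_add:
  "linear_extension scale f (x + y) = linear_extension scale f x + linear_extension scale f y"
proof -
  let ?K = "Poly_Mapping.keys x \<union> Poly_Mapping.keys y"
  have "Poly_Mapping.keys (x + y) \<subseteq> ?K" by (rule Poly_Mapping.keys_add)
  then show ?thesis
    by (simp add: linear_extension_superset[of ?K] lookup_add scale_left_distrib sum.distrib)
qed

lemma linear_extension_zero [simp]: "linear_extension scale f 0 = 0"
  by (simp add: linear_extension_def)

lemma linear_extension_zero_fun [simp]: "linear_extension scale (\<lambda>k. 0) x = 0"
  by (simp add: linear_extension_def)

lemma linear_extension_sum:
  "linear_extension scale f (\<Sum>i\<in>I. x i) = (\<Sum>i\<in>I. linear_extension scale f (x i))"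
  by (induction I rule: infinite_finite_induct) (auto simp: linear_extension_add)

lemma linear_extension_single [simp]:
  "linear_extension scale f (Poly_Mapping.single k c) = scale c (f k)"
  by (simp add: linear_extension_def)

lemma linear_extension_basis [simp]: "linear_extension scale f (basis P) = f P"
  by (simp add: basis_def)

lemma linear_extension_scale:
  "linear_extension scale f (comb_scale c x) = scale c (linear_extension scale f x)"
proof -
  have "Poly_Mapping.keys (comb_scale c x) \<subseteq> Poly_Mapping.keys x"
    by (auto simp: in_keys_iff)
  then show ?thesis
    by (simp add: linear_extension_superset[of "Poly_Mapping.keys x"] scale_sum_right)
qed

lemma linear_extension_diff:
  "linear_extension scale f (x - y) = linear_extension scale f x - linear_extension scale f y"
  using linear_extension_add[of f "x - y" y] by simp

lemma linear_extension_swap: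
  "linear_extension scale (\<lambda>k. linear_extension scale (f k) y) x =
   linear_extension scale (\<lambda>l. linear_extension scale (\<lambda>k. f k l) x) y"
  unfolding linear_extension_def scale_sum_right
  by (subst sum.swap) (simp add: mult.commute)

lemma linear_extension_in_subspace:
  assumes "subspace V" "\<And>k. k \<in> Poly_Mapping.keys x \<Longrightarrow> f k \<in> V"
  shows "linear_extension scale f x \<in> V"
  unfolding linear_extension_def by (intro subspace_sum subspace_scale assms)

text \<open>
  With \<open>linear_extension_swap\<close>, this reduces every identity between iterated products to an
  identity between lists.
\<close>

lemma linear_extension_compose:
  "linear_extension scale f (linear_extension comb_scale g x) =
   linear_extension scale (\<lambda>k. linear_extension scale f (g k)) x"
  unfolding linear_extension_def[of comb_scale] linear_extension_sum linear_extension_scale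
  by (simp add: linear_extension_def)

end

lemma linear_extension_cong:
  "(\<And>k. k \<in> Poly_Mapping.keys x \<Longrightarrow> f k = g k) \<Longrightarrow> linear_extension s f x = linear_extension s g x"
  by (simp add: linear_extension_def)

global_interpretation scalar: vector_space "(*) :: 'f::field \<Rightarrow> 'f \<Rightarrow> 'f"
  by unfold_locales (auto simp: algebra_simps)

abbreviation extend :: "('k \<Rightarrow> 'f::field comb) \<Rightarrow> ('k \<Rightarrow>\<^sub>0 'f) \<Rightarrow> 'f comb" where
  "extend \<equiv> linear_extension comb_scale"

lemma lookup_extend:
  "Poly_Mapping.lookup (extend f x) P = linear_extension (*) (\<lambda>k. Poly_Mapping.lookup (f k) P) x"
  by (simp add: linear_extension_def lookup_sum)

lemma extend_basis_eq: "extend basis x = x"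
proof (rule poly_mapping_eqI)
  fix P
  show "Poly_Mapping.lookup (extend basis x) P = Poly_Mapping.lookup x P"
    by (cases "P \<in> Poly_Mapping.keys x")
      (auto simp: linear_extension_def lookup_sum basis_def lookup_single when_def in_keys_iff
        if_distrib cong: if_cong)
qed

lemma bilinear_ext_eq_extend:
  "bilinear_ext f x y = extend (\<lambda>P. extend (f P) y) x"
  by (simp add: bilinear_ext_def linear_extension_def comb.scale_sum_right)

lemma bilinear_ext_eq_extend_right:
  "bilinear_ext f x y = extend (\<lambda>Q. extend (\<lambda>P. f P Q) x) y"
  unfolding bilinear_ext_eq_extend by (rule comb.linear_extension_swap)

lemma wedge_add_left: "(x + y) \<^bold>\<and> z = x \<^bold>\<and> z + y \<^bold>\<and> z"
  by (simp add: wedge_def bilinear_ext_eq_extend comb.linear_extension_add)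

lemma wedge_add_right: "x \<^bold>\<and> (y + z) = x \<^bold>\<and> y + x \<^bold>\<and> z"
  by (simp add: wedge_def bilinear_ext_eq_extend_right comb.linear_extension_add)

lemma wedge_scale_left: "comb_scale c x \<^bold>\<and> y = comb_scale c (x \<^bold>\<and> y)"
  by (simp add: wedge_def bilinear_ext_eq_extend comb.linear_extension_scale)

lemma wedge_scale_right: "x \<^bold>\<and> comb_scale c y = comb_scale c (x \<^bold>\<and> y)"
  by (simp add: wedge_def bilinear_ext_eq_extend_right comb.linear_extension_scale)

lemma wedge_zero_left [simp]: "0 \<^bold>\<and> y = 0"
  by (simp add: wedge_def bilinear_ext_eq_extend)

lemma wedge_zero_right [simp]: "x \<^bold>\<and> 0 = 0"
  by (simp add: wedge_def bilinear_ext_eq_extend_right)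

section \<open>Set compositions\<close>

definition meet :: "nat set list \<Rightarrow> nat set list \<Rightarrow> nat set list" where
  "meet P Q = filter (\<lambda>Z. Z \<noteq> {}) [X \<inter> Y. X \<leftarrow> P, Y \<leftarrow> Q]"

definition finer :: "nat set list \<Rightarrow> nat set list \<Rightarrow> bool" where
  "finer Q P \<longleftrightarrow> (\<forall>Y\<in>set Q. \<exists>X\<in>set P. Y \<subseteq> X)"

lemma meet_Nil [simp]: "meet [] Q = []"
  by (simp add: meet_def)

text \<open>
  Left multiplication concatenates restrictions.  All later inductions on the left factor
  use this recursive form.
\<close>

lemma meet_Cons [simp]: "meet (X # P) Q = restrict_comp Q X @ meet P Q"
proof -
  have "(\<inter>) X = (\<lambda>Y. Y \<inter> X)" by (auto simp: fun_eq_iff)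
  then show ?thesis by (simp add: meet_def restrict_comp_def)
qed

lemma restrict_comp_simps [simp]:
  "restrict_comp [] X = []"
  "restrict_comp (Y # P) X = (if Y \<inter> X = {} then [] else [Y \<inter> X]) @ restrict_comp P X"
  "restrict_comp (P @ Q) X = restrict_comp P X @ restrict_comp Q X"
  by (auto simp: restrict_comp_def)

lemma set_restrict_comp: "set (restrict_comp P X) = (\<lambda>Y. Y \<inter> X) ` set P - {{}}"
  by (auto simp: restrict_comp_def)

lemma set_meet: "set (meet P Q) = {X \<inter> Y | X Y. X \<in> set P \<and> Y \<in> set Q} - {{}}"
  by (auto simp: meet_def)

lemma restrict_comp_restrict_comp:
  "restrict_comp (restrict_comp P X) Y = restrict_comp P (X \<inter> Y)"
  by (induction P) (auto simp: Int_assoc)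

lemma restrict_comp_empty [simp]: "restrict_comp P {} = []"
  by (induction P) auto

lemma meet_append: "meet (P @ P') Q = meet P Q @ meet P' Q"
  by (induction P) auto

lemma meet_restrict_comp: "meet (restrict_comp P X) Q = restrict_comp (meet P Q) X"
  by (induction P) (auto simp: meet_append restrict_comp_restrict_comp)

lemma meet_assoc: "meet (meet P Q) R = meet P (meet Q R)"
  by (induction P) (auto simp: meet_append meet_restrict_comp)

lemma Nil_in_set_compositions [simp]: "[] \<in> set_compositions A \<longleftrightarrow> A = {}"
  by (auto simp: set_compositions_def partition_on_def)

text \<open>
  Together with the empty list, this describes set compositions recursively, with the ground
  set shrinking; it allows induction on the list.
\<close>

lemma Cons_in_set_compositions [simp]:
  "X # P \<in> set_compositions A \<longleftrightarrow> X \<noteq> {} \<and> X \<subseteq> A \<and> P \<in> set_compositions (A - X)"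
proof
  assume *: "X # P \<in> set_compositions A"
  then have d: "disjoint (insert X (set P))" and "X \<notin> set P"
    by (auto simp: set_compositions_def partition_on_def)
  then have "\<forall>Y\<in>set P. X \<inter> Y = {}"
    by (auto dest: disjointD)
  with * show "X \<noteq> {} \<and> X \<subseteq> A \<and> P \<in> set_compositions (A - X)"
    by (auto simp: set_compositions_def partition_on_def pairwise_insert)
next
  assume *: "X \<noteq> {} \<and> X \<subseteq> A \<and> P \<in> set_compositions (A - X)"
  then have "\<forall>Y\<in>set P. X \<inter> Y = {}"
    by (auto simp: set_compositions_def partition_on_def)
  with * show "X # P \<in> set_compositions A"
    by (auto simp: set_compositions_def partition_on_def pairwise_insert disjnt_def)
qed

lemma append_in_set_compositions:
  assumes "P \<in> set_compositions B" "Q \<in> set_compositions C" "B \<inter> C = {}"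
  shows "P @ Q \<in> set_compositions (B \<union> C)"
  using assms(1,3)
proof (induction P arbitrary: B)
  case Nil
  then show ?case using assms(2) by simp
next
  case (Cons X P)
  then have "P @ Q \<in> set_compositions ((B - X) \<union> C)" by auto
  moreover have "(B - X) \<union> C = (B \<union> C) - X" using Cons.prems by auto
  ultimately show ?case using Cons.prems by auto
qed

lemma restrict_comp_in_set_compositions:
  "P \<in> set_compositions A \<Longrightarrow> restrict_comp P X \<in> set_compositions (A \<inter> X)"
proof (induction P arbitrary: A)
  case (Cons Y P)
  then have IH: "restrict_comp P X \<in> set_compositions ((A - Y) \<inter> X)" by auto
  have "(A - Y) \<inter> X = A \<inter> X - Y \<inter> X" by auto
  with IH Cons.prems show ?case by auto
qed simp

lemma meet_in_set_compositions:
  "P \<in> set_compositions A \<Longrightarrow> Q \<in> set_compositions B \<Longrightarrow> meet P Q \<in> set_compositions (A \<inter> B)"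
proof (induction P arbitrary: A)
  case (Cons X P)
  then have "meet P Q \<in> set_compositions ((A - X) \<inter> B)" by auto
  from append_in_set_compositions[OF restrict_comp_in_set_compositions[OF Cons.prems(2), of X] this]
  have "meet (X # P) Q \<in> set_compositions (B \<inter> X \<union> (A - X) \<inter> B)" by auto
  moreover have "B \<inter> X \<union> (A - X) \<inter> B = A \<inter> B" using Cons.prems by auto
  ultimately show ?case by simp
qed simp

lemma ground_set_composition: "P \<in> set_compositions A \<Longrightarrow> ground P = A"
  by (auto simp: set_compositions_def partition_on_def ground_def)

lemma part_subset: "P \<in> set_compositions A \<Longrightarrow> X \<in> set P \<Longrightarrow> X \<subseteq> A"
  by (auto simp: set_compositions_def partition_on_def)

lemma part_nonempty: "P \<in> set_compositions A \<Longrightarrow> X \<in> set P \<Longrightarrow> X \<noteq> {}"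
  by (auto simp: set_compositions_def partition_on_def)

lemma parts_eqI:
  "P \<in> set_compositions A \<Longrightarrow> X \<in> set P \<Longrightarrow> Y \<in> set P \<Longrightarrow> X \<inter> Y \<noteq> {} \<Longrightarrow> X = Y"
  by (auto simp: set_compositions_def partition_on_def dest: disjointD)

lemma distinct_set_composition: "P \<in> set_compositions A \<Longrightarrow> distinct P"
  by (simp add: set_compositions_def)

lemma finite_set_compositions:
  assumes "finite A"
  shows "finite (set_compositions A)"
proof (rule finite_subset)
  show "set_compositions A \<subseteq> {P. set P \<subseteq> Pow A \<and> distinct P}"
    by (auto simp: set_compositions_def partition_on_def)
  show "finite {P. set P \<subseteq> Pow A \<and> distinct P}"
    using assms by (intro finite_subset_distinct) auto
qed

lemma restrict_comp_cong:
  "(\<And>Y. Y \<in> set P \<Longrightarrow> Y \<inter> X = Y \<inter> X') \<Longrightarrow> restrict_comp P X = restrict_comp P X'"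
  by (auto simp: restrict_comp_def cong: map_cong)

lemma restrict_comp_superset:
  "P \<in> set_compositions A \<Longrightarrow> A \<subseteq> X \<Longrightarrow> restrict_comp P X = P"
  by (induction P arbitrary: A) (auto simp: Int_absorb2)

lemma restrict_comp_disjoint:
  "P \<in> set_compositions A \<Longrightarrow> A \<inter> X = {} \<Longrightarrow> restrict_comp P X = []"
  by (induction P arbitrary: A) auto

text \<open>
  A composition of a subset of \<open>X\<close> only sees the restriction of the right factor to \<open>X\<close>; with
  \<open>X\<close> the complement of the first part, this lets an induction peel off that part.
\<close>

lemma meet_restrict_right:
  "P \<in> set_compositions B \<Longrightarrow> B \<subseteq> X \<Longrightarrow> meet P (restrict_comp R X) = meet P R"
proof (induction P arbitrary: B)
  case (Cons Y P)
  then have "meet P (restrict_comp R X) = meet P R" by (auto intro: Cons.IH)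
  moreover have "X \<inter> Y = Y" using Cons.prems by auto
  ultimately show ?case by (simp add: restrict_comp_restrict_comp)
qed simp

lemma rearrangement_iff_set_eq:
  "P \<in> set_compositions A \<Longrightarrow> Q \<in> set_compositions B \<Longrightarrow> P \<approx> Q \<longleftrightarrow> set P = set Q"
  by (simp add: rearrangement_def set_eq_iff_mset_eq_distinct distinct_set_composition)

lemma rearrangement_set: "P \<approx> Q \<Longrightarrow> set P = set Q"
  by (metis rearrangement_def mset_eq_setD)

lemma rearrangement_length: "P \<approx> Q \<Longrightarrow> length P = length Q"
  by (metis rearrangement_def mset_eq_length)

lemma finer_refl [simp]: "finer P P"
  by (auto simp: finer_def)

lemma finer_trans: "finer P Q \<Longrightarrow> finer Q R \<Longrightarrow> finer P R"
  unfolding finer_def by (meson subset_trans)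

text \<open>
  Mutual refinement forces equal sets of parts, since the parts are non-empty and disjoint.
\<close>

lemma finer_antisym:
  assumes P: "P \<in> set_compositions A" and Q: "Q \<in> set_compositions A"
    and "finer P Q" "finer Q P"
  shows "P \<approx> Q"
proof -
  have *: "set P \<subseteq> set Q" if P: "P \<in> set_compositions A"
    and "finer P Q" "finer Q P" for P Q
  proof
    fix X assume X: "X \<in> set P"
    then obtain Y where Y: "Y \<in> set Q" "X \<subseteq> Y" using \<open>finer P Q\<close> by (auto simp: finer_def)
    then obtain X' where X': "X' \<in> set P" "Y \<subseteq> X'" using \<open>finer Q P\<close> by (auto simp: finer_def)
    have "X = X'" using parts_eqI[OF P X X'(1)] part_nonempty[OF P X] X' Y by auto
    then show "X \<in> set Q" using X' Y by auto
  qed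
  show ?thesis
    using *[OF P] *[OF Q] assms rearrangement_iff_set_eq by blast
qed

lemma finer_meet_iff:
  assumes "Q \<in> set_compositions A"
  shows "finer Q (meet P R) \<longleftrightarrow> finer Q P \<and> finer Q R"
proof
  assume "finer Q (meet P R)"
  moreover have "finer (meet P R) P" "finer (meet P R) R"
    by (auto simp: finer_def set_meet)
  ultimately show "finer Q P \<and> finer Q R" using finer_trans by blast
next
  assume *: "finer Q P \<and> finer Q R"
  show "finer Q (meet P R)"
    unfolding finer_def
  proof
    fix Y assume Y: "Y \<in> set Q"
    with * obtain X X' where "X \<in> set P" "Y \<subseteq> X" "X' \<in> set R" "Y \<subseteq> X'"
      unfolding finer_def by blast
    moreover have "Y \<noteq> {}" using part_nonempty[OF assms Y] .
    ultimately have "X \<inter> X' \<in> set (meet P R)" "Y \<subseteq> X \<inter> X'" by (auto simp: set_meet)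
    then show "\<exists>Z\<in>set (meet P R). Y \<subseteq> Z" by blast
  qed
qed

lemma meet_rearrangement:
  assumes P: "P \<in> set_compositions A" and Q: "Q \<in> set_compositions A" and r: "finer Q P"
  shows "meet P Q \<approx> Q"
proof (rule finer_antisym)
  show "meet P Q \<in> set_compositions A" using meet_in_set_compositions[OF P Q] by simp
  show "finer (meet P Q) Q" by (auto simp: finer_def set_meet)
  show "finer Q (meet P Q)" using r Q by (simp add: finer_meet_iff)
qed (rule Q)

lemma restrict_comp_part:
  "Q \<in> set_compositions A \<Longrightarrow> X \<in> set Q \<Longrightarrow> restrict_comp Q X = [X]"
proof (induction Q arbitrary: A)
  case (Cons Y Q)
  show ?case
  proof (cases "X = Y")
    case True
    then have "restrict_comp Q X = []"
      using Cons.prems by (intro restrict_comp_disjoint[of _ "A - Y"]) auto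
    then show ?thesis using True Cons.prems by simp
  next
    case False
    then have "X \<in> set Q" using Cons.prems by simp
    moreover from this have "Y \<inter> X = {}"
      using part_subset[of Q "A - Y" X] Cons.prems by auto
    ultimately show ?thesis using Cons by auto
  qed
qed simp

lemma meet_absorb_rearrangement:
  assumes "Q \<in> set_compositions A" "Q' \<approx> Q"
  shows "meet Q' Q = Q'"
proof -
  have "set P \<subseteq> set Q \<Longrightarrow> meet P Q = P" for P
    by (induction P) (auto simp: restrict_comp_part[OF assms(1)])
  then show ?thesis using rearrangement_set[OF assms(2)] by simp
qed

lemma length_set_composition_le:
  "P \<in> set_compositions A \<Longrightarrow> finite A \<Longrightarrow> length P \<le> card A"
proof (induction P arbitrary: A)
  case (Cons X P)
  then have "card (A - X) < card A" by (intro psubset_card_mono) auto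
  moreover have "length P \<le> card (A - X)" using Cons by auto
  ultimately show ?case by simp
qed simp

lemma inj_on_Min_parts:
  assumes P: "P \<in> set_compositions A" and "finite A"
  shows "inj_on Min (set P)"
proof (rule inj_onI)
  fix X Y assume XY: "X \<in> set P" "Y \<in> set P" "Min X = Min Y"
  have "Min Z \<in> Z" if "Z \<in> set P" for Z
    using that part_subset[OF P] part_nonempty[OF P] \<open>finite A\<close>
    by (intro Min_in) (auto intro: finite_subset)
  with XY have "X \<inter> Y \<noteq> {}" by (metis disjoint_iff)
  with XY show "X = Y" by (intro parts_eqI[OF P]) auto
qed

lemma ordered_is_set_composition: "Q \<in> ordered_set_compositions A \<Longrightarrow> Q \<in> set_compositions A"
  by (simp add: ordered_set_compositions_def)

lemma finite_ordered_set_compositions: "finite A \<Longrightarrow> finite (ordered_set_compositions A)"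
  using finite_subset[OF _ finite_set_compositions] ordered_is_set_composition by blast

text \<open>
  The minima of the parts are distinct, so sorting by them is strict; the ordered compositions
  are therefore representatives of the rearrangement classes.
\<close>

lemma ordered_rearrangement_exists:
  assumes P: "P \<in> set_compositions A" and "finite A"
  shows "\<exists>Q\<in>ordered_set_compositions A. P \<approx> Q"
proof
  let ?Q = "sort_key Min P"
  show "?Q \<in> ordered_set_compositions A"
    using P inj_on_Min_parts[OF assms]
    by (auto simp: ordered_set_compositions_def set_compositions_def strict_sorted_iff distinct_map)
  show "P \<approx> ?Q" by (simp add: rearrangement_def)
qed

lemma ordered_rearrangement_unique:
  assumes P: "P \<in> ordered_set_compositions A" and Q: "Q \<in> ordered_set_compositions A"
    and "finite A" "P \<approx> Q"
  shows "P = Q"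
proof -
  have s: "set P = set Q" using assms rearrangement_set by blast
  have "map Min P = map Min Q"
    using P Q s by (intro strict_sorted_equal) (auto simp: ordered_set_compositions_def)
  then show ?thesis
    using inj_on_Min_parts[of P A] P s \<open>finite A\<close>
    by (auto simp: ordered_set_compositions_def inj_on_map_eq_map)
qed

section \<open>The algebra on the set compositions of a fixed set\<close>

lemma keys_F_Pi: "x \<in> F_Pi A \<Longrightarrow> P \<in> Poly_Mapping.keys x \<Longrightarrow> P \<in> set_compositions A"
  by (auto simp: F_Pi_def)

lemma subspace_F_Pi: "comb.subspace (F_Pi A)"
proof (rule comb.subspaceI)
  show "0 \<in> F_Pi A" by (simp add: F_Pi_def)
next
  fix x y :: "'a comb" assume "x \<in> F_Pi A" "y \<in> F_Pi A"
  then show "x + y \<in> F_Pi A" using Poly_Mapping.keys_add[of x y] by (auto simp: F_Pi_def)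
next
  fix c and x :: "'a comb" assume "x \<in> F_Pi A"
  moreover have "Poly_Mapping.keys (comb_scale c x) \<subseteq> Poly_Mapping.keys x"
    by (auto simp: in_keys_iff)
  ultimately show "comb_scale c x \<in> F_Pi A" by (auto simp: F_Pi_def)
qed

lemma extend_in_F_Pi:
  "(\<And>k. k \<in> Poly_Mapping.keys x \<Longrightarrow> f k \<in> F_Pi A) \<Longrightarrow> extend f x \<in> F_Pi A"
  by (rule comb.linear_extension_in_subspace[OF subspace_F_Pi])

lemma basis_in_F_Pi [simp]: "basis P \<in> F_Pi A \<longleftrightarrow> P \<in> set_compositions A"
  by (simp add: basis_def F_Pi_def)

lemma wedge_eq_extend:
  assumes "x \<in> F_Pi A" "y \<in> F_Pi A"
  shows "x \<^bold>\<and> y = extend (\<lambda>P. extend (\<lambda>Q. basis (meet P Q)) y) x"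
  unfolding wedge_def bilinear_ext_eq_extend
  using assms[THEN keys_F_Pi, THEN ground_set_composition]
  by (auto intro!: linear_extension_cong simp: meet_def)

lemma wedge_in_F_Pi:
  assumes "x \<in> F_Pi A" "y \<in> F_Pi A"
  shows "x \<^bold>\<and> y \<in> F_Pi A"
  unfolding wedge_eq_extend[OF assms]
proof (intro extend_in_F_Pi)
  fix P Q assume "P \<in> Poly_Mapping.keys x" "Q \<in> Poly_Mapping.keys y"
  with assms have "P \<in> set_compositions A" "Q \<in> set_compositions A"
    by (auto dest: keys_F_Pi)
  from meet_in_set_compositions[OF this] show "basis (meet P Q) \<in> F_Pi A" by simp
qed

lemma wedge_assoc:
  assumes x: "x \<in> F_Pi A" and y: "y \<in> F_Pi A" and z: "z \<in> F_Pi A"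
  shows "(x \<^bold>\<and> y) \<^bold>\<and> z = x \<^bold>\<and> (y \<^bold>\<and> z)"
proof -
  have "(x \<^bold>\<and> y) \<^bold>\<and> z =
      extend (\<lambda>P. extend (\<lambda>Q. extend (\<lambda>R. basis (meet (meet P Q) R)) z) y) x"
    unfolding wedge_eq_extend[OF wedge_in_F_Pi[OF x y] z]
    unfolding wedge_eq_extend[OF x y] comb.linear_extension_compose comb.linear_extension_basis ..
  also have "\<dots> = x \<^bold>\<and> (y \<^bold>\<and> z)"
    unfolding wedge_eq_extend[OF x wedge_in_F_Pi[OF y z]]
    unfolding wedge_eq_extend[OF y z] comb.linear_extension_compose comb.linear_extension_basis
      meet_assoc ..
  finally show ?thesis .
qed

lemma F_Pi_one_in_F_Pi: "F_Pi_one A \<in> F_Pi A"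
  by (auto simp: F_Pi_one_def)

lemma wedge_one_left:
  assumes x: "x \<in> F_Pi A"
  shows "F_Pi_one A \<^bold>\<and> x = x"
proof -
  have "F_Pi_one A \<^bold>\<and> x = extend (\<lambda>Q. basis (meet (if A = {} then [] else [A]) Q)) x"
    unfolding wedge_eq_extend[OF F_Pi_one_in_F_Pi x]
    by (simp add: F_Pi_one_def del: meet_Nil meet_Cons)
  also have "\<dots> = extend basis x"
  proof (rule linear_extension_cong)
    fix Q assume "Q \<in> Poly_Mapping.keys x"
    then have Q: "Q \<in> set_compositions A" using x keys_F_Pi by blast
    then have "A = {} \<Longrightarrow> Q = []" by (cases Q) auto
    with Q show "basis (meet (if A = {} then [] else [A]) Q) = (basis Q :: 'a comb)"
      by (auto simp: restrict_comp_superset)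
  qed
  finally show ?thesis by (simp add: extend_basis_eq)
qed

lemma left_module_F_Pi: "comb.left_module (F_Pi A) wedge (F_Pi_one A) wedge (F_Pi A)"
  unfolding comb.left_module_def
  by (intro conjI ballI allI subspace_F_Pi wedge_in_F_Pi wedge_add_left wedge_add_right
      wedge_scale_left wedge_scale_right wedge_assoc wedge_one_left)

lemma vee_eq_extend:
  assumes "x \<in> F_Pi B" "y \<in> F_Pi C" "B \<inter> C = {}"
  shows "x \<^bold>\<or> y = extend (\<lambda>P. extend (\<lambda>Q. basis (P @ Q)) y) x"
  unfolding vee_def bilinear_ext_eq_extend
  using assms(3) assms(1,2)[THEN keys_F_Pi, THEN ground_set_composition]
  by (auto intro!: linear_extension_cong)

lemma vee_in_F_Pi:
  assumes "x \<in> F_Pi B" "y \<in> F_Pi C" "B \<inter> C = {}"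
  shows "x \<^bold>\<or> y \<in> F_Pi (B \<union> C)"
  unfolding vee_eq_extend[OF assms]
  using assms(1,2)[THEN keys_F_Pi] assms(3)
  by (intro extend_in_F_Pi) (simp add: append_in_set_compositions)

section \<open>Characters\<close>

text \<open>
  Being finer than a meet is being finer than both factors, so these functionals are
  multiplicative.
\<close>

definition character :: "nat set list \<Rightarrow> 'f::field comb \<Rightarrow> 'f" where
  "character Q = linear_extension (*) (\<lambda>P. if finer Q P then 1 else 0)"

lemma character_add: "character Q (x + y) = character Q x + character Q y"
  by (simp add: character_def scalar.linear_extension_add)

lemma character_scale: "character Q (comb_scale c x) = c * character Q x"
  by (simp add: character_def scalar.linear_extension_scale)

lemma character_diff: "character Q (x - y) = character Q x - character Q y"
  by (simp add: character_def scalar.linear_extension_diff)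

lemma character_sum: "character Q (\<Sum>i\<in>I. x i) = (\<Sum>i\<in>I. character Q (x i))"
  by (simp add: character_def scalar.linear_extension_sum)

lemma character_zero [simp]: "character Q 0 = 0"
  by (simp add: character_def)

lemma character_basis: "character Q (basis P) = (if finer Q P then 1 else 0)"
  by (simp add: character_def)

lemma character_eq_lookup:
  assumes "\<And>P. P \<in> Poly_Mapping.keys x \<Longrightarrow> finer Q P \<longleftrightarrow> P = R"
  shows "character Q x = Poly_Mapping.lookup x R"
proof -
  have "character Q x = linear_extension (*) (\<lambda>P. Poly_Mapping.lookup (basis P :: 'a comb) R) x"
    unfolding character_def
    using assms(1) by (intro linear_extension_cong) (simp add: basis_def lookup_single when_def)
  also have "\<dots> = Poly_Mapping.lookup (extend basis x) R" by (simp add: lookup_extend)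
  finally show ?thesis by (simp add: extend_basis_eq)
qed

lemma linear_extension_product:
  "linear_extension (*) (\<lambda>P. linear_extension (*) (\<lambda>R. f P * g R) y) x =
   linear_extension (*) f x * linear_extension (*) g y"
proof -
  have "linear_extension (*) (\<lambda>P. linear_extension (*) (\<lambda>R. f P * g R) y) x =
      (\<Sum>P\<in>Poly_Mapping.keys x. \<Sum>R\<in>Poly_Mapping.keys y.
        Poly_Mapping.lookup x P * (Poly_Mapping.lookup y R * (f P * g R)))"
    by (simp add: linear_extension_def sum_distrib_left)
  also have "\<dots> = (\<Sum>P\<in>Poly_Mapping.keys x. \<Sum>R\<in>Poly_Mapping.keys y.
        (Poly_Mapping.lookup x P * f P) * (Poly_Mapping.lookup y R * g R))"
    by (intro sum.cong refl) (simp only: mult_ac)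
  finally show ?thesis by (simp add: linear_extension_def sum_product)
qed

lemma character_wedge:
  assumes Q: "Q \<in> set_compositions A" and x: "x \<in> F_Pi A" and y: "y \<in> F_Pi A"
  shows "character Q (x \<^bold>\<and> y) = character Q x * character Q y"
proof -
  have eq: "character Q (extend (\<lambda>P. extend (g P) y) x) =
      linear_extension (*) (\<lambda>P. linear_extension (*) (\<lambda>R. character Q (g P R)) y) x" for g
    unfolding character_def by (simp add: scalar.linear_extension_compose)
  have "character Q (x \<^bold>\<and> y) = linear_extension (*)
      (\<lambda>P. linear_extension (*) (\<lambda>R. (if finer Q P then 1 else 0) * (if finer Q R then 1 else 0)) y) x"
    unfolding wedge_eq_extend[OF x y] eq
    by (intro linear_extension_cong) (simp add: character_basis finer_meet_iff[OF Q])
  also have "\<dots> = character Q x * character Q y"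
    by (simp only: character_def linear_extension_product)
  finally show ?thesis .
qed

section \<open>Modules with a unique maximal submodule\<close>

context vector_space_with_modules
begin

lemma left_module_submodule:
  "left_module S mul u act M \<Longrightarrow> submodule S act M N \<Longrightarrow> left_module S mul u act N"
  unfolding left_module_def submodule_def subset_iff
  by (elim conjE, intro conjI ballI allI) simp_all

lemma subspace_module_rad:
  assumes "subspace M"
  shows "subspace (module_rad S act M)"
proof -
  have "module_rad S act M = \<Inter>(insert M {N. maximal_submodule S act M N})"
    by (simp add: module_rad_def)
  also have "subspace \<dots>"
    using assms by (intro subspace_Inter) (auto simp: maximal_submodule_def submodule_def)
  finally show ?thesis .
qed

text \<open>
  If every proper submodule is contained in the proper submodule \<open>N\<close>, then \<open>N\<close> is the only
  maximal submodule, and two proper summands can never add up to more than \<open>N\<close>.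
\<close>

lemma unique_maximal_submodule:
  assumes N: "submodule S act M N" "N \<noteq> M"
    and gen: "\<And>L. submodule S act M L \<Longrightarrow> L \<subseteq> N \<or> L = M"
  shows "module_rad S act M = N" "indecomposable S act M"
proof -
  have NM: "N \<subseteq> M" using N by (simp add: submodule_def)
  have "maximal_submodule S act M L \<longleftrightarrow> L = N" for L
  proof
    assume L: "maximal_submodule S act M L"
    then have "L \<subseteq> N" using gen unfolding maximal_submodule_def by blast
    then show "L = N" using L N unfolding maximal_submodule_def by blast
  next
    assume [simp]: "L = N"
    show "maximal_submodule S act M L"
      unfolding maximal_submodule_def
    proof (intro conjI allI impI)
      fix L' assume "submodule S act M L'" "L \<subseteq> L'"
      then show "L' = L \<or> L' = M" using gen[of L'] by auto
    qed (use N in auto)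
  qed
  then show "module_rad S act M = N"
    using NM by (auto simp: module_rad_def)
  have "0 \<in> N" using N by (auto simp: submodule_def subspace_0)
  show "indecomposable S act M"
    unfolding indecomposable_def
  proof (intro conjI notI)
    assume "M = {0}"
    then show False using \<open>0 \<in> N\<close> N(2) NM by auto
  next
    assume "\<exists>K L. submodule S act M K \<and> submodule S act M L \<and> K \<noteq> {0} \<and> L \<noteq> {0} \<and>
             K \<inter> L = {0} \<and> M = {x + y | x y. x \<in> K \<and> y \<in> L}"
    then obtain K L where KL: "submodule S act M K" "submodule S act M L" "K \<noteq> {0}" "L \<noteq> {0}"
      "K \<inter> L = {0}" and sum: "M = {x + y | x y. x \<in> K \<and> y \<in> L}" by blast
    then have "K \<noteq> M" "L \<noteq> M" by (auto simp: submodule_def)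
    with gen KL have "K \<subseteq> N" "L \<subseteq> N" by auto
    moreover have "subspace N" using N(1) by (simp add: submodule_def)
    ultimately have "M \<subseteq> N" unfolding sum by (auto intro!: subspace_add)
    with N NM show False by auto
  qed
qed

text \<open>
  The kernel of a non-zero functional has codimension one, so there is no room for a
  subspace between it and the module.
\<close>

lemma maximal_submodule_kernel:
  assumes M: "left_module S mul u act M"
    and \<chi>: "\<And>x y. \<chi> (x - y) = \<chi> x - \<chi> y" "\<And>c x. \<chi> (scale c x) = c * \<chi> x"
    and sub: "submodule S act M {x \<in> M. \<chi> x = 0}"
    and w: "w \<in> M" "\<chi> w \<noteq> 0"
  shows "maximal_submodule S act M {x \<in> M. \<chi> x = 0}"
  unfolding maximal_submodule_def
proof (intro conjI allI impI)
  show "{x \<in> M. \<chi> x = 0} \<noteq> M" using w by auto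
  fix L assume L: "submodule S act M L" and le: "{x \<in> M. \<chi> x = 0} \<subseteq> L"
  have LM: "L \<subseteq> M" and sL: "subspace L" using L by (auto simp: submodule_def)
  have sM: "subspace M" using M unfolding left_module_def by blast
  show "L = {x \<in> M. \<chi> x = 0} \<or> L = M"
  proof (cases "\<exists>y\<in>L. \<chi> y \<noteq> 0")
    case True
    then obtain y where y: "y \<in> L" "\<chi> y \<noteq> 0" by blast
    have "z \<in> L" if z: "z \<in> M" for z
    proof -
      let ?c = "\<chi> z / \<chi> y"
      have "z - scale ?c y \<in> M" using z y LM sM by (auto intro!: subspace_diff subspace_scale)
      moreover have "\<chi> (z - scale ?c y) = 0" using y by (simp add: \<chi>)
      ultimately have "z - scale ?c y \<in> L" using le by auto
      from subspace_add[OF sL this subspace_scale[OF sL y(1), of ?c]] show ?thesis by simp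
    qed
    with LM show ?thesis by auto
  qed (use le LM in auto)
qed (rule sub)

text \<open>
  If a maximal submodule \<open>L\<close> did not contain \<open>N\<close>, then \<open>L + N\<close> would be everything, and the
  modular law would give \<open>K = (L \<inter> K) + N\<close>.  As \<open>N\<close> contains all proper submodules of \<open>K\<close>, this
  forces \<open>L \<inter> K = K\<close>, and then \<open>L\<close> contains \<open>N\<close> after all.
\<close>

lemma radical_of_local_submodule:
  assumes M: "left_module S mul u act M" and K: "submodule S act M K"
    and N: "submodule S act K N" "N \<noteq> K"
    and gen: "\<And>L. submodule S act K L \<Longrightarrow> L \<subseteq> N \<or> L = K"
  shows "N \<subseteq> module_rad S act M"
proof -
  have NK: "N \<subseteq> K" and KM: "K \<subseteq> M" using N K by (auto simp: submodule_def)
  have sN: "subspace N" and sM: "subspace M" and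
    act_add: "\<And>a y z. a \<in> S \<Longrightarrow> y \<in> M \<Longrightarrow> z \<in> M \<Longrightarrow> act a (y + z) = act a y + act a z"
    using N M unfolding submodule_def left_module_def by blast+
  have "N \<subseteq> L" if L: "maximal_submodule S act M L" for L
  proof (rule ccontr)
    assume nle: "\<not> N \<subseteq> L"
    have sL: "subspace L" "L \<subseteq> M" and Lact: "\<And>a x. a \<in> S \<Longrightarrow> x \<in> L \<Longrightarrow> act a x \<in> L"
      using L by (auto simp: maximal_submodule_def submodule_def)
    define T where "T = {x + y | x y. x \<in> L \<and> y \<in> N}"
    have "submodule S act M T"
      unfolding submodule_def
    proof (intro conjI ballI)
      show "T \<subseteq> M" using sL NK KM by (auto simp: T_def intro!: subspace_add[OF sM])
      show "subspace T" unfolding T_def by (intro subspace_sums sL sN)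
      fix a x assume a: "a \<in> S" and "x \<in> T"
      then obtain y z where yz: "x = y + z" "y \<in> L" "z \<in> N" by (auto simp: T_def)
      moreover have "y \<in> M" "z \<in> M" using yz sL NK KM by auto
      ultimately have "act a x = act a y + act a z" using act_add a by simp
      moreover have "act a y \<in> L" "act a z \<in> N"
        using Lact[OF a] N(1) a yz by (auto simp: submodule_def)
      ultimately show "act a x \<in> T" unfolding T_def by blast
    qed
    moreover have "L \<subseteq> T"
    proof
      fix x assume "x \<in> L"
      with subspace_0[OF sN] have "x + 0 \<in> T" unfolding T_def by blast
      then show "x \<in> T" by simp
    qed
    moreover have "N \<subseteq> T"
    proof
      fix x assume "x \<in> N"
      with subspace_0[OF sL(1)] have "0 + x \<in> T" unfolding T_def by blast
      then show "x \<in> T" by simp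
    qed
    ultimately have "T = L \<or> T = M" "T \<noteq> L"
      using L nle unfolding maximal_submodule_def by simp_all
    then have T: "T = M" by simp
    have "submodule S act K (L \<inter> K)"
      using L K by (auto simp: maximal_submodule_def submodule_def intro!: subspace_inter)
    from gen[OF this] consider "L \<inter> K \<subseteq> N" | "L \<inter> K = K" by blast
    then show False
    proof cases
      case 1
      have "x \<in> N" if "x \<in> K" for x
      proof -
        have "x \<in> T" using that T KM by auto
        then obtain y z where yz: "x = y + z" "y \<in> L" "z \<in> N" by (auto simp: T_def)
        have "y = x - z" using yz by simp
        also have "\<dots> \<in> K"
        proof (rule subspace_diff)
          show "subspace K" using K by (simp add: submodule_def)
          show "z \<in> K" using yz NK by auto
        qed (rule that)
        finally have "y \<in> N" using 1 yz by auto
        then show ?thesis using yz sN by (auto intro: subspace_add)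
      qed
      then show False using NK N(2) by auto
    next
      case 2
      then show False using NK nle by auto
    qed
  qed
  then show ?thesis using NK KM by (auto simp: module_rad_def)
qed

end

context vector_space
begin

lemma dim_hyperplane:
  assumes "finite G" "M = span G" and N: "subspace N" "N \<subseteq> M"
    and w: "w \<in> M" "w \<notin> N" and gen: "M \<subseteq> span (insert w N)"
  shows "dim M = dim N + 1"
proof -
  obtain B where B: "B \<subseteq> N" "independent B" "N \<subseteq> span B" "card B = dim N"
    using basis_exists by blast
  have "span B = N" using span_minimal[OF B(1) N(1)] B(3) by simp
  have "finite B" using independent_span_bound[OF assms(1) B(2)] B(1) N(2) assms(2) by auto
  have ind: "independent (insert w B)"
    by (rule independent_insertI) (use B w \<open>span B = N\<close> in simp_all)
  have "insert w B \<subseteq> M" using B N w by auto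
  have "insert w N \<subseteq> span (insert w B)"
    using \<open>span B = N\<close> span_mono[of B "insert w B"] span_base by auto
  then have "M \<subseteq> span (insert w B)" using gen span_minimal[OF _ subspace_span] by blast
  then have "dim M = card (insert w B)"
    using dim_unique[OF \<open>insert w B \<subseteq> M\<close> _ ind] by simp
  also have "w \<notin> B" using B w by auto
  then have "card (insert w B) = dim N + 1" using \<open>finite B\<close> B by simp
  finally show ?thesis .
qed

end

section \<open>Primitive idempotents\<close>

text \<open>
  The component of the coproduct of \<open>e\<close> in \<open>F\<Pi>\<^sub>Y \<otimes> F\<Pi>\<^sub>Z\<close>, where \<open>Y = B \<inter> X\<close> and \<open>Z = B - X\<close>, is
  obtained by restricting \<open>e\<close> to \<open>Y\<close> and to \<open>Z\<close>.  For a primitive element it vanishes when both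
  sets are non-empty, and with it any linear image.  The map \<open>g\<close> is arbitrary so that
  the restrictions can be placed inside larger products.
\<close>

lemma primitive_restrict_eq_0:
  fixes e :: "'f::field comb"
  assumes e: "primitive_idempotent B e" and B: "finite B" and X: "B \<inter> X \<noteq> {}" "\<not> B \<subseteq> X"
  shows "extend (\<lambda>R. g (restrict_comp R X) (restrict_comp R (- X))) e = 0"
proof -
  \<comment> \<open>\<open>G\<close> is \<open>g\<close> after the projection to that component; it kills \<open>e \<otimes> \<emptyset>\<close> and \<open>\<emptyset> \<otimes> e\<close>.\<close>
  define G where "G = (\<lambda>(S, T). if ground S = B \<inter> X \<and> ground T = B - X then g S T else 0)"
  have ne: "B \<inter> X \<noteq> {}" "B - X \<noteq> {}" using X by auto
  have e_in: "R \<in> Poly_Mapping.keys e \<Longrightarrow> R \<in> set_compositions B" for R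
    using e by (auto simp: primitive_idempotent_def keys_F_Pi)
  have G: "(\<Sum>Y\<in>Pow B. G (restrict_comp R Y, restrict_comp R (B - Y))) =
      g (restrict_comp R X) (restrict_comp R (- X))" if R: "R \<in> set_compositions B" for R
  proof -
    have "ground (restrict_comp R Y) = B \<inter> Y" for Y
      using restrict_comp_in_set_compositions[OF R] by (rule ground_set_composition)
    then have "(\<Sum>Y\<in>Pow B. G (restrict_comp R Y, restrict_comp R (B - Y))) =
        (\<Sum>Y\<in>Pow B. if Y = B \<inter> X then g (restrict_comp R Y) (restrict_comp R (B - Y)) else 0)"
      by (intro sum.cong refl) (auto simp: G_def)
    also have "\<dots> = g (restrict_comp R (B \<inter> X)) (restrict_comp R (B - B \<inter> X))"
      using B by simp
    also have "restrict_comp R (B \<inter> X) = restrict_comp R X"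
      using part_subset[OF R] by (intro restrict_comp_cong) auto
    also have "restrict_comp R (B - B \<inter> X) = restrict_comp R (- X)"
      using part_subset[OF R] by (intro restrict_comp_cong) auto
    finally show ?thesis .
  qed
  have "extend (\<lambda>R. g (restrict_comp R X) (restrict_comp R (- X))) e =
      (\<Sum>R\<in>Poly_Mapping.keys e. \<Sum>Y\<in>Pow (ground R).
        comb_scale (Poly_Mapping.lookup e R) (G (restrict_comp R Y, restrict_comp R (ground R - Y))))"
    unfolding linear_extension_def
    by (intro sum.cong refl)
      (simp add: G[symmetric] e_in ground_set_composition[OF e_in] comb.scale_sum_right)
  also have "\<dots> = extend G (coproduct e)"
    unfolding coproduct_def by (simp add: comb.linear_extension_sum)
  also have "coproduct e = e \<^bold>\<otimes> basis [] + basis [] \<^bold>\<otimes> e"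
    using e by (simp add: primitive_idempotent_def)
  also have "extend G \<dots> = 0"
    using ne by (auto simp: comb.linear_extension_add tensor_def comb.linear_extension_sum
        G_def ground_def basis_def intro!: sum.neutral)
  finally show ?thesis .
qed

text \<open>
  A composition of \<open>B\<close> with at least two parts annihilates \<open>e\<close>, because it cuts \<open>B\<close>; the
  composition \<open>(B)\<close> is the identity.
\<close>

lemma wedge_primitive:
  assumes e: "primitive_idempotent B e" and B: "finite B" and x: "x \<in> F_Pi B" and "B \<noteq> {}"
  shows "x \<^bold>\<and> e = comb_scale (Poly_Mapping.lookup x [B]) e"
proof -
  have e_in: "e \<in> F_Pi B" using e by (simp add: primitive_idempotent_def)
  have *: "extend (\<lambda>R. basis (meet P R)) e = comb_scale (Poly_Mapping.lookup (basis P) [B]) e"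
    if P: "P \<in> set_compositions B" for P
  proof (cases "P = [B]")
    case True
    have "extend (\<lambda>R. basis (meet P R)) e = extend basis e"
      by (rule linear_extension_cong)
        (use e_in in \<open>auto simp: True restrict_comp_superset dest!: keys_F_Pi\<close>)
    then show ?thesis by (simp add: True extend_basis_eq basis_def)
  next
    case False
    obtain X P' where P': "P = X # P'" using P \<open>B \<noteq> {}\<close> by (cases P) auto
    with P have X: "X \<noteq> {}" "X \<subseteq> B" and P'_in: "P' \<in> set_compositions (B - X)" by auto
    have "X \<noteq> B" using P'_in P' False by (cases P') auto
    have "extend (\<lambda>R. basis (meet P R)) e =
        extend (\<lambda>R. basis (restrict_comp R X @ meet P' (restrict_comp R (- X)))) e"
      using meet_restrict_right[OF P'_in, of "- X"] by (simp add: P' Diff_eq)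
    also have "\<dots> = 0"
      by (rule primitive_restrict_eq_0[OF e B]) (use X \<open>X \<noteq> B\<close> in auto)
    finally show ?thesis using False by (simp add: basis_def lookup_single when_def)
  qed
  have "x \<^bold>\<and> e = extend (\<lambda>P. comb_scale (Poly_Mapping.lookup (basis P) [B]) e) x"
    unfolding wedge_eq_extend[OF x e_in]
    by (rule linear_extension_cong) (use x in \<open>auto intro!: * dest: keys_F_Pi\<close>)
  also have "\<dots> = comb_scale (Poly_Mapping.lookup (extend basis x) [B]) e"
    by (simp add: lookup_extend) (simp add: linear_extension_def comb.scale_sum_left)
  finally show ?thesis by (simp add: extend_basis_eq)
qed

lemma primitive_coefficient:
  assumes e: "primitive_idempotent B e" and B: "finite B" "B \<noteq> {}"
  shows "Poly_Mapping.lookup e [B] = 1"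
proof -
  have "e \<in> F_Pi B" "e \<^bold>\<and> e = e" "e \<noteq> 0" using e by (auto simp: primitive_idempotent_def)
  with wedge_primitive[OF e B(1) _ B(2), of e]
  have "comb_scale (Poly_Mapping.lookup e [B]) e = comb_scale 1 e" by simp
  with \<open>e \<noteq> 0\<close> show ?thesis by (simp only: comb.scale_cancel_right) simp
qed

section \<open>The basis of products of primitive idempotents\<close>

locale primitive_family =
  fixes E :: "nat set \<Rightarrow> 'f::field comb" and A :: "nat set"
  assumes finite_A: "finite A"
    and primitive: "\<And>B. B \<subseteq> A \<Longrightarrow> B \<noteq> {} \<Longrightarrow> primitive_idempotent B (E B)"
begin

lemma E_in_F_Pi: "B \<subseteq> A \<Longrightarrow> B \<noteq> {} \<Longrightarrow> E B \<in> F_Pi B"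
  using primitive by (simp add: primitive_idempotent_def)

lemma E_tuple_Nil [simp]: "E_tuple E [] = basis []"
  by (simp add: E_tuple_def)

lemma E_tuple_in_F_Pi: "Q \<in> set_compositions C \<Longrightarrow> C \<subseteq> A \<Longrightarrow> E_tuple E Q \<in> F_Pi C"
proof (induction Q arbitrary: C)
  case (Cons B Q)
  have "E B \<^bold>\<or> E_tuple E Q \<in> F_Pi (B \<union> (C - B))"
    using Cons by (intro vee_in_F_Pi E_in_F_Pi Cons.IH) auto
  moreover have "B \<union> (C - B) = C" using Cons.prems by auto
  ultimately show ?case by (simp add: E_tuple_def)
qed simp

lemma E_tuple_Cons:
  assumes "B # Q \<in> set_compositions C" "C \<subseteq> A"
  shows "E_tuple E (B # Q) = extend (\<lambda>R. extend (\<lambda>S. basis (R @ S)) (E_tuple E Q)) (E B)"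
proof -
  have "E_tuple E (B # Q) = E B \<^bold>\<or> E_tuple E Q" by (simp add: E_tuple_def)
  also have "\<dots> = extend (\<lambda>R. extend (\<lambda>S. basis (R @ S)) (E_tuple E Q)) (E B)"
    using assms E_in_F_Pi[of B] E_tuple_in_F_Pi[of Q "C - B"]
    by (intro vee_eq_extend[of _ B _ "C - B"]) auto
  finally show ?thesis .
qed

lemma extend_E_tuple_Cons:
  assumes "B # Q \<in> set_compositions C" "C \<subseteq> A"
  shows "extend f (E_tuple E (B # Q)) = extend (\<lambda>R. extend (\<lambda>S. f (R @ S)) (E_tuple E Q)) (E B)"
  unfolding E_tuple_Cons[OF assms] by (simp add: comb.linear_extension_compose)

lemma E_tuple_append:
  assumes "P \<in> set_compositions B" "Q \<in> set_compositions C" "B \<inter> C = {}" "B \<subseteq> A" "C \<subseteq> A"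
  shows "E_tuple E (P @ Q) =
    extend (\<lambda>R. extend (\<lambda>S. basis (R @ S)) (E_tuple E Q)) (E_tuple E P)"
  using assms(1,3,4)
proof (induction P arbitrary: B)
  case Nil
  then show ?case by (simp add: extend_basis_eq)
next
  case (Cons X P)
  have IH: "E_tuple E (P @ Q) =
      extend (\<lambda>R. extend (\<lambda>S. basis (R @ S)) (E_tuple E Q)) (E_tuple E P)"
    using Cons.prems by (intro Cons.IH[of "B - X"]) auto
  have 1: "X # P @ Q \<in> set_compositions (B \<union> C)"
    using append_in_set_compositions[OF Cons.prems(1) assms(2) Cons.prems(2)] by simp
  have 2: "B \<union> C \<subseteq> A" using Cons.prems assms by simp
  show ?case
    unfolding append_Cons E_tuple_Cons[OF 1 2] IH extend_E_tuple_Cons[OF Cons.prems(1,3)]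
    by (simp add: comb.linear_extension_compose)
qed

text \<open>
  The part of the coproduct of \<open>E\<^sub>Q\<close> belonging to \<open>X\<close> and its complement, again tested against
  an arbitrary map \<open>f\<close> of two arguments.  The coproduct is multiplicative for \<open>\<^bold>\<or>\<close>, so each factor
  \<open>E\<^sub>B\<close> goes to the side containing \<open>B\<close>, and a single factor that is split by \<open>X\<close> makes the whole
  expression vanish.
\<close>

lemma E_tuple_restrict:
  assumes "Q \<in> set_compositions C" "C \<subseteq> A"
  shows "extend (\<lambda>R. f (restrict_comp R X) (restrict_comp R (- X))) (E_tuple E Q) =
    (if \<forall>Y\<in>set Q. Y \<subseteq> X \<or> Y \<inter> X = {}
     then extend (\<lambda>R. extend (f R) (E_tuple E (restrict_comp Q (- X))))
            (E_tuple E (restrict_comp Q X))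
     else 0)"
  using assms
proof (induction Q arbitrary: C f)
  case Nil
  then show ?case by simp
next
  case (Cons B Q)
  define c where "c \<longleftrightarrow> (\<forall>Y\<in>set Q. Y \<subseteq> X \<or> Y \<inter> X = {})"
  let ?e = "E_tuple E (restrict_comp Q X)" and ?e' = "E_tuple E (restrict_comp Q (- X))"
  have B: "B \<noteq> {}" "B \<subseteq> C" "B \<subseteq> A" and Q: "Q \<in> set_compositions (C - B)" and "C - B \<subseteq> A"
    using Cons.prems by auto
  have "finite B" using B finite_A finite_subset by auto
  have E_in: "R \<in> set_compositions B" if "R \<in> Poly_Mapping.keys (E B)" for R
    using that E_in_F_Pi[of B] B keys_F_Pi by blast
  have IH: "extend (\<lambda>S. h (restrict_comp S X) (restrict_comp S (- X))) (E_tuple E Q) =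
      (if c then extend (\<lambda>R. extend (h R) ?e') ?e else 0)" for h
    unfolding c_def using Q \<open>C - B \<subseteq> A\<close> by (rule Cons.IH)
  have lhs: "extend (\<lambda>R. f (restrict_comp R X) (restrict_comp R (- X))) (E_tuple E (B # Q)) =
      extend (\<lambda>R. if c then extend (\<lambda>S. extend (\<lambda>S'. f (restrict_comp R X @ S)
        (restrict_comp R (- X) @ S')) ?e') ?e else 0) (E B)"
    unfolding extend_E_tuple_Cons[OF Cons.prems] restrict_comp_simps
      IH[of "\<lambda>S S'. f (restrict_comp _ X @ S) (restrict_comp _ (- X) @ S')"] ..
  consider "B \<subseteq> X" | "B \<inter> X = {}" | "\<not> B \<subseteq> X" "B \<inter> X \<noteq> {}" by blast
  then show ?case
  proof cases
    case 1
    have split: "(\<forall>Y\<in>set (B # Q). Y \<subseteq> X \<or> Y \<inter> X = {}) \<longleftrightarrow> c"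
      using 1 by (auto simp: c_def)
    from 1 have "B \<inter> - X = {}" "B \<inter> X = B" by auto
    have comp: "B # restrict_comp Q X \<in> set_compositions (C \<inter> X)"
      using restrict_comp_in_set_compositions[OF Cons.prems(1), of X] \<open>B \<inter> X = B\<close> B(1) by simp
    have "extend (\<lambda>R. if c then extend (\<lambda>S. extend (\<lambda>S'. f (restrict_comp R X @ S)
        (restrict_comp R (- X) @ S')) ?e') ?e else 0) (E B) =
        extend (\<lambda>R. if c then extend (\<lambda>S. extend (\<lambda>S'. f (R @ S) S') ?e') ?e else 0) (E B)"
      using 1 \<open>B \<inter> - X = {}\<close>
      by (intro linear_extension_cong)
        (simp add: restrict_comp_superset[OF E_in] restrict_comp_disjoint[OF E_in])
    also have "\<dots> = (if c then extend (\<lambda>R. extend (f R) ?e') (E_tuple E (B # restrict_comp Q X)) else 0)"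
      using Cons.prems(2) by (simp add: extend_E_tuple_Cons[OF comp] le_infI1)
    finally show ?thesis
      using lhs split B(1) \<open>B \<inter> - X = {}\<close> \<open>B \<inter> X = B\<close> by simp
  next
    case 2
    have split: "(\<forall>Y\<in>set (B # Q). Y \<subseteq> X \<or> Y \<inter> X = {}) \<longleftrightarrow> c"
      using 2 by (auto simp: c_def)
    from 2 have B': "B \<subseteq> - X" "B \<inter> - X = B" by auto
    have comp: "B # restrict_comp Q (- X) \<in> set_compositions (C \<inter> - X)"
      using restrict_comp_in_set_compositions[OF Cons.prems(1), of "- X"] B' B(1) by simp
    have "extend (\<lambda>R. if c then extend (\<lambda>S. extend (\<lambda>S'. f (restrict_comp R X @ S)
        (restrict_comp R (- X) @ S')) ?e') ?e else 0) (E B) =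
        extend (\<lambda>R. if c then extend (\<lambda>S. extend (\<lambda>S'. f S (R @ S')) ?e') ?e else 0) (E B)"
      using 2 B'
      by (intro linear_extension_cong)
        (simp add: restrict_comp_superset[OF E_in] restrict_comp_disjoint[OF E_in])
    also have "\<dots> = (if c then extend (\<lambda>S. extend (\<lambda>R. extend (\<lambda>S'. f S (R @ S')) ?e') (E B)) ?e else 0)"
      by (simp add: comb.linear_extension_swap[of _ ?e])
    also have "\<dots> = (if c then extend (\<lambda>S. extend (f S) (E_tuple E (B # restrict_comp Q (- X)))) ?e else 0)"
      using Cons.prems(2) by (simp add: extend_E_tuple_Cons[OF comp] le_infI1)
    finally show ?thesis
      using lhs split 2 B(1) B' by simp
  next
    case 3
    have "extend (\<lambda>R. if c then extend (\<lambda>S. extend (\<lambda>S'. f (restrict_comp R X @ S)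
        (restrict_comp R (- X) @ S')) ?e') ?e else 0) (E B) = 0"
      by (rule primitive_restrict_eq_0[OF primitive[OF B(3,1)] \<open>finite B\<close> 3(2,1)])
    then show ?thesis unfolding lhs using 3 by (simp add: c_def)
  qed
qed

text \<open>
  The multiplication rule.  Peeling off the first part \<open>X\<close> of the left factor reduces it to
  \<open>E_tuple_restrict\<close> for \<open>X\<close>, followed by induction on the complement of \<open>X\<close>; this is
  why the ground set \<open>C\<close> varies.
\<close>

lemma extend_meet_E_tuple:
  assumes "P \<in> set_compositions C" "Q \<in> set_compositions C" "C \<subseteq> A"
  shows "extend (\<lambda>R. basis (meet P R)) (E_tuple E Q) =
    (if finer Q P then E_tuple E (meet P Q) else 0)"
  using assms
proof (induction P arbitrary: C Q)
  case Nil
  then have "Q = []" by (cases Q) auto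
  then show ?case by simp
next
  case (Cons X P)
  let ?Q = "restrict_comp Q (- X)"
  define c where "c \<longleftrightarrow> (\<forall>Y\<in>set Q. Y \<subseteq> X \<or> Y \<inter> X = {})"
  have X: "X \<subseteq> C" and P: "P \<in> set_compositions (C - X)" and CX: "C - X \<subseteq> A" "C \<inter> X \<subseteq> A"
    using Cons.prems by auto
  have meet_P: "meet P (restrict_comp R (- X)) = meet P R" for R
    by (rule meet_restrict_right[OF P]) auto
  have Q': "?Q \<in> set_compositions (C - X)"
    using restrict_comp_in_set_compositions[OF Cons.prems(2), of "- X"] by (simp add: Diff_eq)
  have IH: "extend (\<lambda>S. basis (meet P S)) (E_tuple E ?Q) =
      (if finer ?Q P then E_tuple E (meet P ?Q) else 0)"
    by (rule Cons.IH[OF P Q' CX(1)])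
  have finer: "finer Q (X # P) \<longleftrightarrow> c \<and> finer ?Q P"
  proof
    assume r: "finer Q (X # P)"
    have disj: "Z \<inter> X = {}" if "Z \<in> set P" for Z using part_subset[OF P that] by auto
    have c: c
      unfolding c_def
    proof
      fix Y assume "Y \<in> set Q"
      with r consider "Y \<subseteq> X" | Z where "Z \<in> set P" "Y \<subseteq> Z" by (auto simp: finer_def)
      then show "Y \<subseteq> X \<or> Y \<inter> X = {}" using disj by cases blast+
    qed
    have "finer ?Q P"
      unfolding finer_def
    proof
      fix Z assume "Z \<in> set ?Q"
      then obtain Y where Y: "Y \<in> set Q" "Z = Y \<inter> - X" "Z \<noteq> {}" by (auto simp: set_restrict_comp)
      then have "\<not> Y \<subseteq> X" by auto
      then obtain W where "W \<in> set P" "Y \<subseteq> W" using r Y by (auto simp: finer_def)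
      then show "\<exists>W\<in>set P. Z \<subseteq> W" using Y by auto
    qed
    with c show "c \<and> finer ?Q P" by simp
  next
    assume r: "c \<and> finer ?Q P"
    show "finer Q (X # P)"
      unfolding finer_def
    proof
      fix Y assume Y: "Y \<in> set Q"
      show "\<exists>W\<in>set (X # P). Y \<subseteq> W"
      proof (cases "Y \<subseteq> X")
        case False
        then have "Y \<inter> - X = Y" using r Y by (auto simp: c_def)
        moreover have "Y \<noteq> {}" using False by auto
        ultimately have "Y \<in> set ?Q" using Y by (force simp: set_restrict_comp)
        then show ?thesis using r by (auto simp: finer_def)
      qed simp
    qed
  qed
  have "extend (\<lambda>R. basis (meet (X # P) R)) (E_tuple E Q) =
      extend (\<lambda>R. basis (restrict_comp R X @ meet P (restrict_comp R (- X)))) (E_tuple E Q)"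
    by (simp add: meet_P)
  also have "\<dots> = (if c then extend (\<lambda>R. extend (\<lambda>S. basis (R @ meet P S)) (E_tuple E ?Q))
      (E_tuple E (restrict_comp Q X)) else 0)"
    unfolding c_def by (rule E_tuple_restrict[OF Cons.prems(2,3)])
  also have "(\<lambda>R. extend (\<lambda>S. basis (R @ meet P S)) (E_tuple E ?Q)) =
      (\<lambda>R. extend (\<lambda>S. basis (R @ S)) (extend (\<lambda>S. basis (meet P S)) (E_tuple E ?Q)))"
    by (simp add: comb.linear_extension_compose)
  also have "(if c then extend \<dots> (E_tuple E (restrict_comp Q X)) else 0) =
      (if c \<and> finer ?Q P then extend (\<lambda>R. extend (\<lambda>S. basis (R @ S)) (E_tuple E (meet P ?Q)))
        (E_tuple E (restrict_comp Q X)) else 0)"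
    unfolding IH by simp
  also have "extend (\<lambda>R. extend (\<lambda>S. basis (R @ S)) (E_tuple E (meet P ?Q)))
        (E_tuple E (restrict_comp Q X)) = E_tuple E (restrict_comp Q X @ meet P ?Q)"
    using meet_in_set_compositions[OF P Q'] CX
    by (intro E_tuple_append[OF restrict_comp_in_set_compositions[OF Cons.prems(2)], symmetric]) auto
  also have "restrict_comp Q X @ meet P ?Q = meet (X # P) Q"
    by (simp add: meet_P)
  finally show ?case by (simp only: finer)
qed

lemma basis_wedge_E_tuple:
  assumes "P \<in> set_compositions A" "Q \<in> set_compositions A"
  shows "basis P \<^bold>\<and> E_tuple E Q = (if finer Q P then E_tuple E (meet P Q) else 0)"
  using wedge_eq_extend[of "basis P" A "E_tuple E Q"] assms
  by (simp add: E_tuple_in_F_Pi extend_meet_E_tuple[of P A])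

text \<open>
  With \<open>lookup_E_tuple_self\<close> this is the triangularity of the family \<open>E\<^sub>Q\<close> with respect to the
  number of parts.
\<close>

lemma keys_E_tuple:
  assumes "Q \<in> set_compositions C" "C \<subseteq> A" "R \<in> Poly_Mapping.keys (E_tuple E Q)"
  shows "finer R Q" "R = Q \<or> length Q < length R"
proof -
  have "finer R Q \<and> (R = Q \<or> length Q < length R)" using assms
  proof (induction Q arbitrary: C R)
    case Nil
    then show ?case by (simp add: basis_def)
  next
    case (Cons B Q)
    have B: "B \<noteq> {}" "B \<subseteq> A" and Q: "Q \<in> set_compositions (C - B)" and "C - B \<subseteq> A"
      using Cons.prems by auto
    have "\<exists>R1\<in>Poly_Mapping.keys (E B). \<exists>R2\<in>Poly_Mapping.keys (E_tuple E Q). R = R1 @ R2"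
    proof (rule ccontr)
      assume no: "\<not> ?thesis"
      have "Poly_Mapping.lookup (E_tuple E (B # Q)) R = 0"
        unfolding E_tuple_Cons[OF Cons.prems(1,2)] lookup_extend
        using no by (auto simp: linear_extension_def basis_def lookup_single when_def
            intro!: sum.neutral) blast
      with Cons.prems(3) show False by (simp add: in_keys_iff)
    qed
    then obtain R1 R2 where R1: "R1 \<in> Poly_Mapping.keys (E B)"
      and R2: "R2 \<in> Poly_Mapping.keys (E_tuple E Q)" and R: "R = R1 @ R2" by blast
    have R1': "R1 \<in> set_compositions B" using R1 E_in_F_Pi[OF B(2,1)] keys_F_Pi by blast
    have "R1 = [B] \<or> 1 < length R1"
    proof (cases R1)
      case Nil then show ?thesis using R1' B by simp
    next
      case (Cons X R') then show ?thesis using R1' by (cases R') auto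
    qed
    moreover have "finer R2 Q \<and> (R2 = Q \<or> length Q < length R2)"
      by (rule Cons.IH[OF Q \<open>C - B \<subseteq> A\<close> R2])
    ultimately show ?case using part_subset[OF R1'] by (auto simp: R finer_def)
  qed
  then show "finer R Q" "R = Q \<or> length Q < length R" by auto
qed

lemma lookup_E_tuple_self:
  assumes "Q \<in> set_compositions C" "C \<subseteq> A"
  shows "Poly_Mapping.lookup (E_tuple E Q) Q = 1"
  using assms
proof (induction Q arbitrary: C)
  case Nil
  then show ?case by (simp add: basis_def)
next
  case (Cons B Q)
  have B: "B \<noteq> {}" "B \<subseteq> A" and Q: "Q \<in> set_compositions (C - B)" "C - B \<subseteq> A"
    using Cons.prems by auto
  have eq: "Poly_Mapping.lookup (basis (R @ S) :: 'f comb) (B # Q) =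
      Poly_Mapping.lookup (basis R :: 'f comb) [B] * Poly_Mapping.lookup (basis S :: 'f comb) Q"
    if "R \<in> Poly_Mapping.keys (E B)" for R S
  proof -
    have R: "R \<in> set_compositions B" using that E_in_F_Pi[OF B(2,1)] keys_F_Pi by blast
    have "R @ S = B # Q \<longleftrightarrow> R = [B] \<and> S = Q"
    proof
      assume RS: "R @ S = B # Q"
      then obtain R' where R': "R = B # R'" using R B by (cases R) auto
      with R have "R' = []" by (cases R') auto
      with R' RS show "R = [B] \<and> S = Q" by simp
    qed simp
    then show ?thesis by (simp add: basis_def lookup_single when_def)
  qed
  have "Poly_Mapping.lookup (E_tuple E (B # Q)) (B # Q) = linear_extension (*) (\<lambda>R.
      linear_extension (*) (\<lambda>S. Poly_Mapping.lookup (basis R :: 'f comb) [B] *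
        Poly_Mapping.lookup (basis S :: 'f comb) Q) (E_tuple E Q)) (E B)"
    unfolding E_tuple_Cons[OF Cons.prems] lookup_extend
    by (intro linear_extension_cong) (simp add: eq)
  also have "\<dots> = Poly_Mapping.lookup (extend basis (E B)) [B] *
      Poly_Mapping.lookup (extend basis (E_tuple E Q)) Q"
    by (simp only: linear_extension_product lookup_extend)
  also have "\<dots> = 1"
    using primitive_coefficient[OF primitive[OF B(2,1)] finite_subset[OF B(2) finite_A] B(1)]
      Cons.IH[OF Q] by (simp add: extend_basis_eq)
  finally show ?case .
qed

section \<open>The modules generated by the products\<close>

text \<open>
  This is the radical of \<open>\<Lambda>\<^sub>Q\<close>, by \<open>module_rad_Lambda\<close> below.
\<close>

definition radical_span :: "nat set list \<Rightarrow> 'f comb set" where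
  "radical_span Q =
     comb.span {E_tuple E Q - E_tuple E Q' | Q'. Q' \<in> set_compositions A \<and> Q' \<approx> Q}"

lemma E_tuple_in: "Q \<in> set_compositions A \<Longrightarrow> E_tuple E Q \<in> F_Pi A"
  by (rule E_tuple_in_F_Pi) auto

lemma wedge_E_tuple:
  assumes x: "x \<in> F_Pi A" and Q: "Q \<in> set_compositions A"
  shows "x \<^bold>\<and> E_tuple E Q =
    extend (\<lambda>P. if finer Q P then E_tuple E (meet P Q) else 0) x"
  unfolding wedge_eq_extend[OF x E_tuple_in[OF Q]]
  by (intro linear_extension_cong extend_meet_E_tuple[OF keys_F_Pi[OF x] Q]) auto

lemma basis_wedge_rearrangement:
  assumes Q: "Q \<in> set_compositions A" and Q': "Q' \<in> set_compositions A" and r: "Q' \<approx> Q"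
  shows "basis Q' \<^bold>\<and> E_tuple E Q = E_tuple E Q'"
proof -
  have "finer Q Q'" using rearrangement_set[OF r] by (auto simp: finer_def)
  then show ?thesis
    using basis_wedge_E_tuple[OF Q' Q] meet_absorb_rearrangement[OF Q r] by simp
qed

text \<open>
  The multiplication rule sends \<open>E\<^sub>Q\<close> only to multiples of rearranged products, and each
  rearrangement \<open>Q'\<close> is reached by multiplying with \<open>Q'\<close> itself.
\<close>

lemma Lambda_eq_span:
  assumes Q: "Q \<in> set_compositions A"
  shows "Lambda E A Q = comb.span {E_tuple E Q' | Q'. Q' \<in> set_compositions A \<and> Q' \<approx> Q}"
    (is "_ = comb.span ?G")
proof
  show "Lambda E A Q \<subseteq> comb.span ?G"
  proof
    fix y assume "y \<in> Lambda E A Q"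
    then obtain x where x: "x \<in> F_Pi A" and y: "y = x \<^bold>\<and> E_tuple E Q" by (auto simp: Lambda_def)
    show "y \<in> comb.span ?G"
      unfolding y wedge_E_tuple[OF x Q]
    proof (rule comb.linear_extension_in_subspace[OF comb.subspace_span])
      fix P assume "P \<in> Poly_Mapping.keys x"
      then have P: "P \<in> set_compositions A" using x keys_F_Pi by blast
      have "E_tuple E (meet P Q) \<in> ?G" if "finer Q P"
        using meet_in_set_compositions[OF P Q] meet_rearrangement[OF P Q that] by auto
      then show "(if finer Q P then E_tuple E (meet P Q) else 0) \<in> comb.span ?G"
        using comb.span_base[of "E_tuple E (meet P Q)" ?G] by (simp add: comb.span_zero)
    qed
  qed
  show "comb.span ?G \<subseteq> Lambda E A Q"
  proof (rule comb.span_minimal)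
    show "?G \<subseteq> Lambda E A Q"
    proof
      fix y assume "y \<in> ?G"
      then obtain Q' where "Q' \<in> set_compositions A" "Q' \<approx> Q" "y = E_tuple E Q'" by blast
      with basis_wedge_rearrangement[OF Q] show "y \<in> Lambda E A Q"
        unfolding Lambda_def by (metis (mono_tags, lifting) basis_in_F_Pi mem_Collect_eq)
    qed
    show "comb.subspace (Lambda E A Q)"
    proof (rule comb.subspaceI)
      show "0 \<in> Lambda E A Q"
        unfolding Lambda_def using comb.subspace_0[OF subspace_F_Pi, of A] wedge_zero_left
        by (metis (mono_tags, lifting) mem_Collect_eq)
    next
      fix x y assume "x \<in> Lambda E A Q" "y \<in> Lambda E A Q"
      then obtain x' y' where "x' \<in> F_Pi A" "y' \<in> F_Pi A" "x = x' \<^bold>\<and> E_tuple E Q"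
        "y = y' \<^bold>\<and> E_tuple E Q" by (auto simp: Lambda_def)
      then have "x' + y' \<in> F_Pi A" "x + y = (x' + y') \<^bold>\<and> E_tuple E Q"
        by (auto simp: wedge_add_left intro: comb.subspace_add[OF subspace_F_Pi])
      then show "x + y \<in> Lambda E A Q" by (auto simp: Lambda_def)
    next
      fix c x assume "x \<in> Lambda E A Q"
      then obtain x' where "x' \<in> F_Pi A" "x = x' \<^bold>\<and> E_tuple E Q" by (auto simp: Lambda_def)
      then have "comb_scale c x' \<in> F_Pi A" "comb_scale c x = comb_scale c x' \<^bold>\<and> E_tuple E Q"
        by (auto simp: wedge_scale_left intro: comb.subspace_scale[OF subspace_F_Pi])
      then show "comb_scale c x \<in> Lambda E A Q" by (auto simp: Lambda_def)
    qed
  qed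
qed

lemma E_tuple_in_Lambda:
  "Q \<in> set_compositions A \<Longrightarrow> Q' \<in> set_compositions A \<Longrightarrow> Q' \<approx> Q \<Longrightarrow> E_tuple E Q' \<in> Lambda E A Q"
  unfolding Lambda_eq_span by (rule comb.span_base) blast

lemma Lambda_induct:
  assumes "x \<in> Lambda E A Q" "Q \<in> set_compositions A" "comb.subspace {x. \<phi> x}"
    and "\<And>Q'. Q' \<in> set_compositions A \<Longrightarrow> Q' \<approx> Q \<Longrightarrow> \<phi> (E_tuple E Q')"
  shows "\<phi> x"
  using assms(1) unfolding Lambda_eq_span[OF assms(2)]
  by (rule comb.span_induct) (use assms in auto)

lemma submodule_Lambda:
  assumes Q: "Q \<in> set_compositions A"
  shows "comb.submodule (F_Pi A) wedge (F_Pi A) (Lambda E A Q)"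
  unfolding comb.submodule_def
proof (intro conjI ballI)
  show "Lambda E A Q \<subseteq> F_Pi A"
    using wedge_in_F_Pi[OF _ E_tuple_in[OF Q]] by (auto simp: Lambda_def)
  show "comb.subspace (Lambda E A Q)" unfolding Lambda_eq_span[OF Q] by (rule comb.subspace_span)
  fix a x :: "'f comb" assume a: "a \<in> F_Pi A" and "x \<in> Lambda E A Q"
  then obtain y where y: "y \<in> F_Pi A" "x = y \<^bold>\<and> E_tuple E Q" by (auto simp: Lambda_def)
  then have "a \<^bold>\<and> x = (a \<^bold>\<and> y) \<^bold>\<and> E_tuple E Q"
    using wedge_assoc[OF a y(1) E_tuple_in[OF Q]] by simp
  then show "a \<^bold>\<and> x \<in> Lambda E A Q"
    using wedge_in_F_Pi[OF a y(1)] by (auto simp: Lambda_def)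
qed

lemmas Lambda_in_F_Pi = submodule_Lambda[unfolded comb.submodule_def, THEN conjunct1, THEN subsetD]

lemmas subspace_Lambda =
  submodule_Lambda[unfolded comb.submodule_def, THEN conjunct2, THEN conjunct1]

text \<open>
  Since \<open>\<chi>\<^sub>R(R) = 1\<close>, multiplying \<open>E\<^sub>Q\<close> by \<open>R\<close> from the left preserves the value of \<open>\<chi>\<^sub>R\<close>.
  The product is \<open>0\<close>, or it is \<open>E\<close> at \<open>R \<^bold>\<and> Q\<close>, whose terms are all finer than \<open>R \<^bold>\<and> Q\<close>: then
  \<open>\<chi>\<^sub>R\<close> can only see a term when \<open>R\<close> rearranges \<open>Q\<close>, and in that case it sees the leading
  term \<open>R\<close> alone, with coefficient \<open>1\<close>.
\<close>

lemma character_E_tuple: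
  assumes R: "R \<in> set_compositions A" and Q: "Q \<in> set_compositions A"
  shows "character R (E_tuple E Q) = (if R \<approx> Q then 1 else 0)"
proof -
  let ?M = "meet R Q"
  have M: "?M \<in> set_compositions A" using meet_in_set_compositions[OF R Q] by simp
  have keys: "P \<in> set_compositions A" "finer P ?M" "P = ?M \<or> length ?M < length P"
    if "P \<in> Poly_Mapping.keys (E_tuple E ?M)" for P
    using keys_E_tuple[OF M _ that] keys_F_Pi[OF E_tuple_in[OF M] that] by auto
  have "character R (E_tuple E Q) = character R (basis R \<^bold>\<and> E_tuple E Q)"
    using R by (simp add: character_wedge[OF R _ E_tuple_in[OF Q]] character_basis)
  also have "\<dots> = (if finer Q R then character R (E_tuple E ?M) else 0)"
    by (simp add: basis_wedge_E_tuple[OF R Q])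
  also have "\<dots> = (if R \<approx> Q then 1 else 0)"
  proof (cases "R \<approx> Q")
    case True
    then have "finer Q R" using rearrangement_set by (auto simp: finer_def)
    have MR: "?M = R" by (rule meet_absorb_rearrangement[OF Q True])
    have "finer R P \<longleftrightarrow> P = R" if "P \<in> Poly_Mapping.keys (E_tuple E R)" for P
    proof
      assume "finer R P"
      with keys[of P, unfolded MR, OF that] have "P \<approx> R" by (intro finer_antisym[OF _ R])
      then show "P = R" using keys(3)[of P, unfolded MR, OF that] rearrangement_length by fastforce
    qed simp
    then have "character R (E_tuple E R) = 1"
      by (simp add: character_eq_lookup[of _ R R] lookup_E_tuple_self[OF R])
    with True MR \<open>finer Q R\<close> show ?thesis by simp
  next
    case False
    have "character R (E_tuple E ?M) = 0" if "finer Q R"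
    proof -
      have "\<not> finer R P" if "P \<in> Poly_Mapping.keys (E_tuple E ?M)" for P
      proof
        assume "finer R P"
        then have "finer R ?M" using keys(2)[OF that] finer_trans by blast
        then have "finer R Q" by (simp add: finer_meet_iff[OF R])
        then show False using False finer_antisym[OF R Q] \<open>finer Q R\<close> by simp
      qed
      then show ?thesis by (simp add: character_def linear_extension_def)
    qed
    then show ?thesis using False by simp
  qed
  finally show ?thesis .
qed

text \<open>
  Each rearrangement \<open>Q'\<close> sends all the generators of \<open>\<Lambda>\<^sub>Q\<close> to the same element \<open>E\<^sub>Q\<^sub>'\<close>, so it
  sums up the coefficients, which is what \<open>\<chi>\<^sub>Q\<close> does.
\<close>

lemma basis_wedge_Lambda:
  assumes Q: "Q \<in> set_compositions A" and Q': "Q' \<in> set_compositions A" "Q' \<approx> Q"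
    and x: "x \<in> Lambda E A Q"
  shows "basis Q' \<^bold>\<and> x = comb_scale (character Q x) (E_tuple E Q')"
  using x Q
proof (rule Lambda_induct)
  show "comb.subspace {x. basis Q' \<^bold>\<and> x = comb_scale (character Q x) (E_tuple E Q')}"
    by (rule comb.subspaceI)
      (simp_all add: wedge_add_right wedge_scale_right character_add character_scale
        comb.scale_left_distrib)
next
  fix R assume R: "R \<in> set_compositions A" "R \<approx> Q"
  then have "Q' \<approx> R" "Q \<approx> R" using Q' by (simp_all add: rearrangement_def)
  then show "basis Q' \<^bold>\<and> E_tuple E R = comb_scale (character Q (E_tuple E R)) (E_tuple E Q')"
    using basis_wedge_rearrangement[OF R(1) Q'(1)] by (simp add: character_E_tuple[OF Q R(1)])
qed

lemma character_Lambda_eq_0: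
  assumes Q: "Q \<in> set_compositions A" and R: "R \<in> set_compositions A" and "\<not> R \<approx> Q"
    and x: "x \<in> Lambda E A Q"
  shows "character R x = 0"
  using x Q
proof (rule Lambda_induct)
  show "comb.subspace {x. character R x = 0}"
    by (rule comb.subspaceI) (simp_all add: character_add character_scale)
next
  fix Q' assume "Q' \<in> set_compositions A" "Q' \<approx> Q"
  then show "character R (E_tuple E Q') = 0"
    using \<open>\<not> R \<approx> Q\<close> by (simp add: character_E_tuple[OF R] rearrangement_def)
qed

lemma radical_span_eq_kernel:
  assumes Q: "Q \<in> set_compositions A"
  shows "radical_span Q = {x \<in> Lambda E A Q. character Q x = 0}"
proof
  show "radical_span Q \<subseteq> {x \<in> Lambda E A Q. character Q x = 0}"
    unfolding radical_span_def
  proof (rule comb.span_minimal)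
    show "{E_tuple E Q - E_tuple E Q' | Q'. Q' \<in> set_compositions A \<and> Q' \<approx> Q} \<subseteq>
        {x \<in> Lambda E A Q. character Q x = 0}"
      using Q by (auto simp: character_diff character_E_tuple rearrangement_def
        intro!: comb.subspace_diff[OF subspace_Lambda] E_tuple_in_Lambda)
    show "comb.subspace {x \<in> Lambda E A Q. character Q x = 0}"
      using subspace_Lambda[OF Q]
      by (intro comb.subspaceI)
        (auto simp: character_add character_scale intro: comb.subspace_0 comb.subspace_add comb.subspace_scale)
  qed
  show "{x \<in> Lambda E A Q. character Q x = 0} \<subseteq> radical_span Q"
  proof
    fix x assume "x \<in> {x \<in> Lambda E A Q. character Q x = 0}"
    then have x: "x \<in> Lambda E A Q" "character Q x = 0" by auto
    \<comment> \<open>Modulo the differences, every generator equals \<open>E\<^sub>Q\<close>, so \<open>x\<close> equals \<open>\<chi>\<^sub>Q(x) E\<^sub>Q\<close>.\<close>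
    have "x - comb_scale (character Q x) (E_tuple E Q) \<in> radical_span Q"
      using x(1) Q
    proof (rule Lambda_induct)
      have sub: "comb.subspace (radical_span Q)" by (simp add: radical_span_def)
      show "comb.subspace {x. x - comb_scale (character Q x) (E_tuple E Q) \<in> radical_span Q}"
      proof (rule comb.subspaceI, goal_cases)
        case 1
        then show ?case using comb.subspace_0[OF sub] by simp
      next
        case (2 x y)
        then show ?case
          using comb.subspace_add[OF sub, of "x - comb_scale (character Q x) (E_tuple E Q)"
              "y - comb_scale (character Q y) (E_tuple E Q)"]
          by (simp add: character_add comb.scale_left_distrib algebra_simps)
      next
        case (3 c x)
        then show ?case
          using comb.subspace_scale[OF sub, of "x - comb_scale (character Q x) (E_tuple E Q)" c]
          by (simp add: character_scale comb.scale_right_diff_distrib)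
      qed
      fix R assume R: "R \<in> set_compositions A" "R \<approx> Q"
      have "E_tuple E Q - E_tuple E R \<in> radical_span Q"
        unfolding radical_span_def by (rule comb.span_base) (use R in blast)
      from comb.subspace_neg[OF sub this] R
      show "E_tuple E R - comb_scale (character Q (E_tuple E R)) (E_tuple E Q) \<in> radical_span Q"
        by (simp add: character_E_tuple[OF Q] rearrangement_def)
    qed
    then show "x \<in> radical_span Q" by (simp add: x(2))
  qed
qed

lemma submodule_radical_span:
  assumes Q: "Q \<in> set_compositions A"
  shows "comb.submodule (F_Pi A) wedge (Lambda E A Q) (radical_span Q)"
  unfolding comb.submodule_def
proof (intro conjI ballI)
  show "comb.subspace (radical_span Q)" by (simp add: radical_span_def)
  show "radical_span Q \<subseteq> Lambda E A Q" by (auto simp: radical_span_eq_kernel[OF Q])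
  fix a x :: "'f comb" assume "a \<in> F_Pi A" "x \<in> radical_span Q"
  then show "a \<^bold>\<and> x \<in> radical_span Q"
    using submodule_Lambda[OF Q] Lambda_in_F_Pi[OF Q]
    by (auto simp: radical_span_eq_kernel[OF Q] character_wedge[OF Q] comb.submodule_def)
qed

lemma radical_span_proper:
  assumes Q: "Q \<in> set_compositions A"
  shows "E_tuple E Q \<in> Lambda E A Q - radical_span Q" "radical_span Q \<noteq> Lambda E A Q"
proof -
  show 1: "E_tuple E Q \<in> Lambda E A Q - radical_span Q"
    using E_tuple_in_Lambda[OF Q Q]
    by (simp add: radical_span_eq_kernel[OF Q] character_E_tuple[OF Q Q] rearrangement_def)
  then show "radical_span Q \<noteq> Lambda E A Q" by blast
qed

text \<open>
  An element \<open>x\<close> outside the kernel of \<open>\<chi>\<^sub>Q\<close> produces every generator \<open>E\<^sub>Q\<^sub>'\<close> of \<open>\<Lambda>\<^sub>Q\<close>, up to the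
  invertible factor \<open>\<chi>\<^sub>Q(x)\<close>.
\<close>

lemma submodule_Lambda_cases:
  assumes Q: "Q \<in> set_compositions A" and L: "comb.submodule (F_Pi A) wedge (Lambda E A Q) L"
  shows "L \<subseteq> radical_span Q \<or> L = Lambda E A Q"
proof (rule disjCI)
  assume "L \<noteq> Lambda E A Q"
  have LL: "L \<subseteq> Lambda E A Q" and sub: "comb.subspace L"
    and act: "\<And>a x. a \<in> F_Pi A \<Longrightarrow> x \<in> L \<Longrightarrow> a \<^bold>\<and> x \<in> L"
    using L by (auto simp: comb.submodule_def)
  show "L \<subseteq> radical_span Q"
  proof (rule ccontr)
    assume "\<not> L \<subseteq> radical_span Q"
    then obtain x where x: "x \<in> L" "character Q x \<noteq> 0"
      using LL by (auto simp: radical_span_eq_kernel[OF Q])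
    have "E_tuple E Q' \<in> L" if Q': "Q' \<in> set_compositions A" "Q' \<approx> Q" for Q'
    proof -
      have "basis Q' \<^bold>\<and> x \<in> L" using act x(1) Q' by simp
      then have "comb_scale (character Q x) (E_tuple E Q') \<in> L"
        using basis_wedge_Lambda[OF Q Q'] x LL by auto
      from comb.subspace_scale[OF sub this, of "inverse (character Q x)"] x(2)
      show ?thesis by simp
    qed
    then have "Lambda E A Q \<subseteq> L"
      unfolding Lambda_eq_span[OF Q] by (intro comb.span_minimal[OF _ sub]) auto
    with LL \<open>L \<noteq> Lambda E A Q\<close> show False by simp
  qed
qed

lemma indecomposable_Lambda:
  assumes Q: "Q \<in> set_compositions A"
  shows "comb.indecomposable (F_Pi A) wedge (Lambda E A Q)"
  by (rule comb.unique_maximal_submodule(2)[OF submodule_radical_span[OF Q]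
        radical_span_proper(2)[OF Q] submodule_Lambda_cases[OF Q]])

lemma module_rad_Lambda:
  assumes Q: "Q \<in> set_compositions A"
  shows "comb.module_rad (F_Pi A) wedge (Lambda E A Q) = radical_span Q"
  by (rule comb.unique_maximal_submodule(1)[OF submodule_radical_span[OF Q]
        radical_span_proper(2)[OF Q] submodule_Lambda_cases[OF Q]])

lemma dim_Lambda:
  assumes Q: "Q \<in> set_compositions A"
  shows "comb.dim (Lambda E A Q) = comb.dim (radical_span Q) + 1"
proof (rule comb.dim_hyperplane[OF _ Lambda_eq_span[OF Q]])
  show "finite {E_tuple E Q' | Q'. Q' \<in> set_compositions A \<and> Q' \<approx> Q}"
    using finite_set_compositions[OF finite_A] by simp
  show "comb.subspace (radical_span Q)" by (simp add: radical_span_def)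
  show "radical_span Q \<subseteq> Lambda E A Q" by (auto simp: radical_span_eq_kernel[OF Q])
  show "E_tuple E Q \<in> Lambda E A Q" "E_tuple E Q \<notin> radical_span Q"
    using radical_span_proper(1)[OF Q] by auto
  show "Lambda E A Q \<subseteq> comb.span (insert (E_tuple E Q) (radical_span Q))"
  proof
    fix x assume x: "x \<in> Lambda E A Q"
    let ?c = "comb_scale (character Q x) (E_tuple E Q)"
    have "x - ?c \<in> radical_span Q"
      unfolding radical_span_eq_kernel[OF Q]
      using x E_tuple_in_Lambda[OF Q Q] subspace_Lambda[OF Q]
      by (auto simp: character_diff character_scale character_E_tuple[OF Q Q] rearrangement_def
          intro!: comb.subspace_diff comb.subspace_scale)
    then have "(x - ?c) + ?c \<in> comb.span (insert (E_tuple E Q) (radical_span Q))"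
      by (intro comb.span_add comb.span_scale comb.span_base) auto
    then show "x \<in> comb.span (insert (E_tuple E Q) (radical_span Q))" by simp
  qed
qed

section \<open>The decomposition\<close>

lemma lookup_E_tuple:
  assumes Q: "Q \<in> set_compositions A" and "length R \<le> length Q"
  shows "Poly_Mapping.lookup (E_tuple E Q) R = (if R = Q then 1 else 0)"
proof -
  have "R \<in> Poly_Mapping.keys (E_tuple E Q) \<Longrightarrow> R = Q"
    using keys_E_tuple(2)[OF Q order_refl, of R] assms(2) by auto
  then show ?thesis using lookup_E_tuple_self[OF Q] by (auto simp: in_keys_iff)
qed

lemma lookup_Lambda_eq_0:
  assumes Q: "Q \<in> set_compositions A" and x: "x \<in> Lambda E A Q"
    and R: "length R \<le> length Q" "\<not> R \<approx> Q"
  shows "Poly_Mapping.lookup x R = 0"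
  using x Q
proof (rule Lambda_induct)
  show "comb.subspace {x. Poly_Mapping.lookup x R = 0}"
    by (rule comb.subspaceI) (simp_all add: lookup_add)
next
  fix Q' assume Q': "Q' \<in> set_compositions A" "Q' \<approx> Q"
  then show "Poly_Mapping.lookup (E_tuple E Q') R = 0"
    using lookup_E_tuple[OF Q'(1), of R] R rearrangement_length[OF Q'(2)] by auto
qed

text \<open>
  The members of one rearrangement class have the same number of parts, so by triangularity
  the coefficient of \<open>x\<close> at the composition \<open>R\<close> is also its coordinate at \<open>E\<^sub>R\<close>.
\<close>

lemma Lambda_coordinates:
  assumes Q: "Q \<in> set_compositions A" and x: "x \<in> Lambda E A Q"
  shows "x = (\<Sum>R | R \<in> set_compositions A \<and> R \<approx> Q. comb_scale (Poly_Mapping.lookup x R) (E_tuple E R))"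
    (is "_ = sum _ ?C")
  using x Q
proof (rule Lambda_induct)
  show "comb.subspace {x. x = (\<Sum>R\<in>?C. comb_scale (Poly_Mapping.lookup x R) (E_tuple E R))}"
    by (rule comb.subspaceI)
      (simp_all add: lookup_add comb.scale_left_distrib sum.distrib
        flip: comb.scale_scale comb.scale_sum_right)
next
  fix Q' assume Q': "Q' \<in> set_compositions A" "Q' \<approx> Q"
  have "(\<Sum>R\<in>?C. comb_scale (Poly_Mapping.lookup (E_tuple E Q') R) (E_tuple E R)) =
      (\<Sum>R\<in>?C. if R = Q' then E_tuple E R else 0)"
    using rearrangement_length Q' by (intro sum.cong refl) (auto simp: lookup_E_tuple)
  also have "\<dots> = E_tuple E Q'"
    using Q' finite_set_compositions[OF finite_A] by simp
  finally show "E_tuple E Q' =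
    (\<Sum>R\<in>?C. comb_scale (Poly_Mapping.lookup (E_tuple E Q') R) (E_tuple E R))" ..
qed

text \<open>
  Induction on the number of parts: once the summands with fewer parts are known to vanish,
  the coefficients at the rearrangements of \<open>Q\<close> come from \<open>h Q\<close> alone, and they determine it.
\<close>

lemma Lambda_independent:
  assumes h: "\<And>Q. Q \<in> ordered_set_compositions A \<Longrightarrow> h Q \<in> Lambda E A Q"
    and sum: "(\<Sum>Q\<in>ordered_set_compositions A. h Q) = 0"
  shows "Q \<in> ordered_set_compositions A \<Longrightarrow> h Q = 0"
proof (induction "length Q" arbitrary: Q rule: less_induct)
  case less
  let ?O = "ordered_set_compositions A"
  note O = ordered_is_set_composition and fin = finite_ordered_set_compositions[OF finite_A]
  have "Poly_Mapping.lookup (h Q) R = 0" if R: "R \<in> set_compositions A" "R \<approx> Q" for R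
  proof -
    have other: "Poly_Mapping.lookup (h Q1) R = 0" if Q1: "Q1 \<in> ?O - {Q}" for Q1
    proof (cases "length Q1 < length Q")
      case True
      then show ?thesis using less(1) Q1 by simp
    next
      case False
      have "\<not> R \<approx> Q1"
      proof
        assume "R \<approx> Q1"
        with R(2) have "Q1 \<approx> Q" by (simp add: rearrangement_def)
        then show False using ordered_rearrangement_unique[OF _ less.prems finite_A] Q1 by auto
      qed
      then show ?thesis
        using False Q1 rearrangement_length[OF R(2)]
        by (intro lookup_Lambda_eq_0[OF O h]) auto
    qed
    have "0 = Poly_Mapping.lookup (\<Sum>Q\<in>?O. h Q) R" by (simp add: sum)
    also have "\<dots> = (\<Sum>Q\<in>?O. Poly_Mapping.lookup (h Q) R)" by (rule lookup_sum)
    also have "\<dots> = Poly_Mapping.lookup (h Q) R"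
      using fin less.prems other by (simp add: sum.remove)
    finally show ?thesis ..
  qed
  then show ?case
    by (subst Lambda_coordinates[OF O[OF less.prems] h[OF less.prems]]) simp
qed

text \<open>
  Solving the triangular system from the compositions with the most parts downwards.
\<close>

lemma basis_in_span_E_tuple:
  "Q \<in> set_compositions A \<Longrightarrow> basis Q \<in> comb.span (E_tuple E ` set_compositions A)"
proof (induction "card A - length Q" arbitrary: Q rule: less_induct)
  case less
  let ?K = "Poly_Mapping.keys (E_tuple E Q)" and ?V = "comb.span (E_tuple E ` set_compositions A)"
  let ?t = "\<lambda>R. comb_scale (Poly_Mapping.lookup (E_tuple E Q) R) (basis R)"
  have self: "Poly_Mapping.lookup (E_tuple E Q) Q = 1" by (rule lookup_E_tuple_self[OF less.prems order_refl])
  then have "Q \<in> ?K" by (simp add: in_keys_iff)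
  have "E_tuple E Q = sum ?t ?K"
    using extend_basis_eq[of "E_tuple E Q"] by (simp add: linear_extension_def)
  also have "\<dots> = basis Q + sum ?t (?K - {Q})"
    using \<open>Q \<in> ?K\<close> self by (simp add: sum.remove)
  finally have "basis Q = E_tuple E Q - sum ?t (?K - {Q})" by (simp add: eq_diff_eq)
  also have "\<dots> \<in> ?V"
  proof (intro comb.span_diff comb.span_sum comb.span_scale)
    show "E_tuple E Q \<in> ?V" using less.prems by (intro comb.span_base) auto
    fix R assume R: "R \<in> ?K - {Q}"
    then have R': "R \<in> set_compositions A" using keys_F_Pi[OF E_tuple_in[OF less.prems]] by auto
    have "length Q < length R" using keys_E_tuple(2)[OF less.prems order_refl] R by auto
    then show "basis R \<in> ?V"
      using length_set_composition_le[OF R' finite_A] by (intro less.hyps[OF _ R']) auto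
  qed
  finally show ?case .
qed

lemma F_Pi_subset_span_E_tuple: "F_Pi A \<subseteq> comb.span (E_tuple E ` set_compositions A)"
proof
  fix x :: "'f comb" assume x: "x \<in> F_Pi A"
  have "extend basis x \<in> comb.span (E_tuple E ` set_compositions A)"
    using x by (intro comb.linear_extension_in_subspace comb.subspace_span basis_in_span_E_tuple)
      (auto dest: keys_F_Pi)
  then show "x \<in> comb.span (E_tuple E ` set_compositions A)" by (simp add: extend_basis_eq)
qed

lemma F_Pi_decompose:
  assumes "x \<in> F_Pi A"
  shows "\<exists>f. f \<in> (\<Pi>\<^sub>E Q\<in>ordered_set_compositions A. Lambda E A Q) \<and>
    x = (\<Sum>Q\<in>ordered_set_compositions A. f Q)" (is "\<exists>f. f \<in> ?P \<and> x = sum f ?O")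
proof -
  note O = ordered_is_set_composition and fin = finite_ordered_set_compositions[OF finite_A]
  have "x \<in> comb.span (E_tuple E ` set_compositions A)" using F_Pi_subset_span_E_tuple assms by auto
  then show ?thesis
  proof (rule comb.span_induct)
    show "comb.subspace {x. \<exists>f. f \<in> ?P \<and> x = sum f ?O}"
    proof (rule comb.subspaceI, goal_cases)
      case 1
      show ?case
        using comb.subspace_0[OF subspace_Lambda[OF O]]
        by (intro CollectI exI[of _ "\<lambda>Q\<in>?O. 0"]) auto
    next
      case (2 x y)
      then obtain f g where "f \<in> ?P" "g \<in> ?P" "x = sum f ?O" "y = sum g ?O" by blast
      then show ?case
        using comb.subspace_add[OF subspace_Lambda[OF O]]
        by (intro CollectI exI[of _ "\<lambda>Q\<in>?O. f Q + g Q"]) (auto simp: sum.distrib PiE_mem)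
    next
      case (3 c x)
      then obtain f where "f \<in> ?P" "x = sum f ?O" by blast
      then show ?case
        using comb.subspace_scale[OF subspace_Lambda[OF O]]
        by (intro CollectI exI[of _ "\<lambda>Q\<in>?O. comb_scale c (f Q)"]) (auto simp: comb.scale_sum_right PiE_mem)
    qed
  next
    fix y assume "y \<in> E_tuple E ` set_compositions A"
    then obtain Q where Q: "Q \<in> set_compositions A" "y = E_tuple E Q" by blast
    obtain R where R: "R \<in> ?O" "Q \<approx> R" using ordered_rearrangement_exists[OF Q(1) finite_A] by blast
    have "(\<lambda>S\<in>?O. if S = R then y else 0) \<in> ?P"
      using comb.subspace_0[OF subspace_Lambda[OF O]] E_tuple_in_Lambda[OF O[OF R(1)] Q(1) R(2)] Q(2)
      by auto
    moreover have "y = (\<Sum>S\<in>?O. (\<lambda>S\<in>?O. if S = R then y else 0) S)"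
      using fin R(1) by simp
    ultimately show "\<exists>f. f \<in> ?P \<and> y = sum f ?O" by blast
  qed
qed

lemma direct_sum_Lambda:
  "comb.finite_direct_sum (F_Pi A) wedge (F_Pi A) (ordered_set_compositions A) (Lambda E A)"
  unfolding comb.finite_direct_sum_def
proof (intro conjI ballI)
  let ?O = "ordered_set_compositions A" and ?P = "\<Pi>\<^sub>E Q\<in>ordered_set_compositions A. Lambda E A Q"
  note O = ordered_is_set_composition
  show "finite ?O" by (rule finite_ordered_set_compositions[OF finite_A])
  show "comb.submodule (F_Pi A) wedge (F_Pi A) (Lambda E A Q)" if "Q \<in> ?O" for Q
    by (rule submodule_Lambda[OF O[OF that]])
  fix x :: "'f comb" assume x: "x \<in> F_Pi A"
  show "\<exists>!f. f \<in> ?P \<and> x = (\<Sum>i\<in>?O. f i)"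
  proof (rule ex_ex1I[OF F_Pi_decompose[OF x]])
    fix f g assume f: "f \<in> ?P \<and> x = (\<Sum>i\<in>?O. f i)" and g: "g \<in> ?P \<and> x = (\<Sum>i\<in>?O. g i)"
    have "f Q - g Q = 0" if "Q \<in> ?O" for Q
    proof (rule Lambda_independent[OF _ _ that])
      show "f Q - g Q \<in> Lambda E A Q" if "Q \<in> ?O" for Q
        using f g that by (intro comb.subspace_diff[OF subspace_Lambda[OF O]]) (auto simp: PiE_mem)
      show "(\<Sum>Q\<in>?O. f Q - g Q) = 0" using f g by (simp add: sum_subtractf)
    qed
    then show "f = g" using f g by (intro PiE_ext[of f ?O "Lambda E A" g]) auto
  qed
qed

lemma maximal_kernel_character:
  assumes Q: "Q \<in> set_compositions A"
  shows "comb.maximal_submodule (F_Pi A) wedge (F_Pi A)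
    {x \<in> F_Pi A :: 'f comb set. character Q x = 0}"
proof (rule comb.maximal_submodule_kernel[OF left_module_F_Pi])
  show "comb.submodule (F_Pi A) wedge (F_Pi A) {x \<in> F_Pi A. character Q x = 0}"
    unfolding comb.submodule_def
  proof (intro conjI ballI)
    show "comb.subspace {x \<in> F_Pi A. character Q x = 0}"
      using subspace_F_Pi[of A]
      by (intro comb.subspaceI)
        (auto simp: character_add character_scale intro: comb.subspace_0 comb.subspace_add comb.subspace_scale)
  qed (auto simp: character_wedge[OF Q] wedge_in_F_Pi)
  show "E_tuple E Q \<in> F_Pi A" by (rule E_tuple_in[OF Q])
  show "character Q (E_tuple E Q) \<noteq> 0" by (simp add: character_E_tuple[OF Q Q] rearrangement_def)
qed (simp_all add: character_diff character_scale)

text \<open>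
  Each local summand contributes its radical.  Conversely, an element of the radical is
  killed by all characters; as \<open>\<chi>\<^sub>Q\<close> vanishes on the other summands, it kills the component in
  \<open>\<Lambda>\<^sub>Q\<close>, which then lies in the radical of \<open>\<Lambda>\<^sub>Q\<close>.
\<close>

lemma module_rad_F_Pi:
  "comb.module_rad (F_Pi A) wedge (F_Pi A) =
     comb.span {E_tuple E Q - E_tuple E Q' | Q Q'.
       Q \<in> ordered_set_compositions A \<and> Q' \<in> set_compositions A \<and> Q' \<approx> Q}"
  (is "?rad = comb.span ?G")
proof
  let ?O = "ordered_set_compositions A"
  note O = ordered_is_set_composition and fin = finite_ordered_set_compositions[OF finite_A]
  show "comb.span ?G \<subseteq> ?rad"
  proof (rule comb.span_minimal[OF _ comb.subspace_module_rad[OF subspace_F_Pi]])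
    show "?G \<subseteq> ?rad"
    proof
      fix x assume "x \<in> ?G"
      then obtain Q Q' where Q: "Q \<in> ?O" and "Q' \<in> set_compositions A" "Q' \<approx> Q"
        "x = E_tuple E Q - E_tuple E Q'" by blast
      then have "x \<in> radical_span Q"
        unfolding radical_span_def by (intro comb.span_base) blast
      moreover have "radical_span Q \<subseteq> ?rad"
        by (rule comb.radical_of_local_submodule[OF left_module_F_Pi submodule_Lambda[OF O[OF Q]]
              submodule_radical_span[OF O[OF Q]] radical_span_proper(2)[OF O[OF Q]]
              submodule_Lambda_cases[OF O[OF Q]]])
      ultimately show "x \<in> ?rad" by blast
    qed
  qed
  show "?rad \<subseteq> comb.span ?G"
  proof
    fix x assume x: "x \<in> ?rad"
    then have "x \<in> F_Pi A" by (simp add: comb.module_rad_def)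
    from F_Pi_decompose[OF this] obtain f where f: "\<And>Q. Q \<in> ?O \<Longrightarrow> f Q \<in> Lambda E A Q"
      and x_eq: "x = (\<Sum>Q\<in>?O. f Q)" by (auto simp: PiE_mem)
    have "f Q \<in> comb.span ?G" if Q: "Q \<in> ?O" for Q
    proof -
      have "character Q (f R) = 0" if "R \<in> ?O - {Q}" for R
        using that Q ordered_rearrangement_unique[OF Q _ finite_A, of R]
        by (intro character_Lambda_eq_0[OF O O _ f]) auto
      then have "character Q x = character Q (f Q)"
        unfolding x_eq sum.remove[OF fin Q] by (simp add: character_add character_sum)
      moreover have "character Q x = 0"
        using x maximal_kernel_character[OF O[OF Q]] by (auto simp: comb.module_rad_def)
      ultimately have "f Q \<in> radical_span Q"
        using f[OF Q] by (simp add: radical_span_eq_kernel[OF O[OF Q]])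
      moreover have "radical_span Q \<subseteq> comb.span ?G"
        unfolding radical_span_def using Q by (intro comb.span_mono) blast
      ultimately show ?thesis by blast
    qed
    then show "x \<in> comb.span ?G" unfolding x_eq by (rule comb.span_sum)
  qed
qed

end

theorem theorem5p4:
  fixes E :: "nat set \<Rightarrow> 'f::field comb" and A :: "nat set"
  assumes E: "\<And>B. finite B \<Longrightarrow> B \<noteq> {} \<Longrightarrow> B \<subseteq> {1..} \<Longrightarrow> primitive_idempotent B (E B)"
    and A: "finite A" "A \<subseteq> {1..}"
  shows "(\<forall>Q\<in>set_compositions A.
            Lambda E A Q = comb.span {E_tuple E Q' | Q'. Q' \<in> set_compositions A \<and> Q' \<approx> Q} \<and>
            comb.left_module (F_Pi A) wedge (F_Pi_one A) wedge (Lambda E A Q) \<and>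
            comb.indecomposable (F_Pi A) wedge (Lambda E A Q) \<and>
            comb.module_rad (F_Pi A) wedge (Lambda E A Q) =
              comb.span {E_tuple E Q - E_tuple E Q' | Q'. Q' \<in> set_compositions A \<and> Q' \<approx> Q} \<and>
            comb.dim (Lambda E A Q) =
              comb.dim (comb.module_rad (F_Pi A) wedge (Lambda E A Q)) + 1) \<and>
         comb.finite_direct_sum (F_Pi A) wedge (F_Pi A)
           (ordered_set_compositions A) (Lambda E A) \<and>
         (\<forall>Q\<in>ordered_set_compositions A.
            comb.indecomposable (F_Pi A) wedge (Lambda E A Q)) \<and>
         comb.module_rad (F_Pi A) wedge (F_Pi A) =
           comb.span {E_tuple E Q - E_tuple E Q' | Q Q'.
             Q \<in> ordered_set_compositions A \<and> Q' \<in> set_compositions A \<and> Q' \<approx> Q}"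
proof -
  interpret primitive_family E A
  proof
    show "finite A" by (rule A)
    show "primitive_idempotent B (E B)" if "B \<subseteq> A" "B \<noteq> {}" for B
      using that A by (intro E) (auto intro: finite_subset)
  qed
  have left: "comb.left_module (F_Pi A) wedge (F_Pi_one A) wedge (Lambda E A Q)"
    if "Q \<in> set_compositions A" for Q
    by (rule comb.left_module_submodule[OF left_module_F_Pi submodule_Lambda[OF that]])
  show ?thesis
    using ordered_is_set_composition
    by (intro conjI ballI Lambda_eq_span left indecomposable_Lambda
        module_rad_Lambda[unfolded radical_span_def] direct_sum_Lambda module_rad_F_Pi)
      (simp_all add: module_rad_Lambda dim_Lambda)
qed

end
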